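(* The following inclusions hold: $$\mathcal{Z}\big(\mathcal{E}_{<\frac\pi2}(\overline{\mathcal{R}})\big)\subseteq\mathcal{Z}\big(\mathcal{M}^2_\omega(\mathcal{R})\cap\operatorname{Hol}(\overline{\mathcal{R}})\big)\subseteq\mathcal{Z}\big(\mathcal{E}_{\frac\pi2}(\overline{\mathcal{R}})\big).$$
   Context: $\mathcal{R}=\{z\in\mathbf{C}:\Re z>0\}$, $\overline{\mathcal{R}}$ its closure, and $\operatorname{Hol}(\overline{\mathcal{R}})$ denotes the functions holomorphic on (a neighborhood of) $\overline{\mathcal{R}}$. For $0<b<\infty$, $S_b=\{x+iy:0<x<b\}$ and $H^2(S_b)$ is the space of holomorphic $f$ on $S_b$ with $\sup_{0<x<b}\int_{-\infty}^{+\infty}|f(x+iy)|^2\,dy<\infty$; such functions have $L^2$ boundary values on the imaginary axis. Let $\omega=\sum_{n=0}^{+\infty}\frac{2^n}{n!}\,\delta_{n/2}(x)\otimes dy$ on $\overline{\mathcal{R}}$. $\mathcal{M}^2_\omega(\mathcal{R})$ is the space of holomorphic functions $f$ on $\mathcal{R}$ such that $f\in H^2(S_b)$ for every $0<b<\infty$ and $f\in L^2(\overline{\mathcal{R}},d\omega)$, i.e. $\sum_{n\ge0}\frac{2^n}{n!}\int_{-\infty}^{+\infty}|f(\frac n2+iy)|^2\,dy<\infty$ (boundary values used for $n=0$). $\mathcal{E}_\tau(\overline{\mathcal{R}})$ is the space of $f\in\operatorname{Hol}(\overline{\mathcal{R}})$ of exponential type (at most) $\tau$, i.e. for every $\varepsilon>0$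 there is $C>0$ with $|f(z)|\le Ce^{(\tau+\varepsilon)|z|}$ on $\overline{\mathcal{R}}$; $\mathcal{E}_{<\tau}(\overline{\mathcal{R}})$ is the space of those of exponential type less than $\tau$, i.e. $\bigcup_{0\le\tau'<\tau}\mathcal{E}_{\tau'}(\overline{\mathcal{R}})$. For a space $\mathcal{K}\subseteq\operatorname{Hol}(\overline{\mathcal{R}})$, $\mathcal{Z}(\mathcal{K})$ denotes the collection of zero-sets for $\mathcal{K}$, i.e. of the zero sets in $\overline{\mathcal{R}}$ (with multiplicity) of functions in $\mathcal{K}$ that are not identically zero. *)

theory Defs
  imports "HOL-Complex_Analysis.Complex_Analysis" "HOL-Probability.Probability"
begin

definition rhp :: "complex set" where
  "rhp = {z. 0 < Re z}"

definition Hol_rhp :: "(complex \<Rightarrow> complex) set" where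
  "Hol_rhp = {f. f analytic_on closure rhp}"

definition strip :: "real \<Rightarrow> complex set" where
  "strip b = {z. 0 < Re z \<and> Re z < b}"

definition H2 :: "real \<Rightarrow> (complex \<Rightarrow> complex) set" where
  "H2 b = {f. f holomorphic_on strip b \<and>
     (SUP x\<in>{0<..<b}. \<integral>\<^sup>+y. ennreal ((cmod (f (Complex x y)))\<^sup>2) \<partial>lborel) < \<infinity>}"

text \<open>
  \<open>nu\<close> is the measure $\sum_n \frac{2^n}{n!} \delta_{n/2}$ on the real line, and \<open>omega\<close> the product
  of it with Lebesgue measure; see \<open>nn_integral_omega\<close> below.
\<close>

definition nu :: "real measure" where
  "nu = distr (density (count_space (UNIV :: nat set)) (\<lambda>n. ennreal (2 ^ n / fact n)))
          borel (\<lambda>n. real n / 2)"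

definition omega :: "complex measure" where
  "omega = distr (nu \<Otimes>\<^sub>M lborel) borel (\<lambda>(x, y). Complex x y)"

text \<open>
  Elements of the spaces below are functions on the open half-plane, represented by total
  functions. On the imaginary axis their values are therefore irrelevant and the boundary
  values, i.e. the horizontal limits from the right (which exist almost everywhere for
  functions in \<^term>\<open>H2 b\<close>), are used instead.
\<close>

definition bdry_ext :: "(complex \<Rightarrow> complex) \<Rightarrow> complex \<Rightarrow> complex" where
  "bdry_ext f z =
     (if 0 < Re z then f z
      else if Re z = 0 then Lim (at_right 0) (\<lambda>x. f (Complex x (Im z)))
      else 0)"

definition M2_omega :: "(complex \<Rightarrow> complex) set" where
  "M2_omega = {f. f holomorphic_on rhp \<and> (\<forall>b>0. f \<in> H2 b) \<and>
     bdry_ext f \<in> borel_measurable omega \<and> integrable omega (\<lambda>z. (cmod (bdry_ext f z))\<^sup>2)}"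

definition exp_type :: "real \<Rightarrow> (complex \<Rightarrow> complex) set" where
  "exp_type \<tau> = {f \<in> Hol_rhp. \<forall>\<epsilon>>0. \<exists>C>0. \<forall>z\<in>closure rhp. cmod (f z) \<le> C * exp ((\<tau> + \<epsilon>) * cmod z)}"

definition exp_type_less :: "real \<Rightarrow> (complex \<Rightarrow> complex) set" where
  "exp_type_less \<tau> = (\<Union>\<tau>'\<in>{0..<\<tau>}. exp_type \<tau>')"

text \<open>
  A zero set with multiplicities is encoded as the function assigning to each point its
  multiplicity as a zero in the closed half-plane (0 if it is not such a zero).
\<close>

definition zero_mult :: "(complex \<Rightarrow> complex) \<Rightarrow> complex \<Rightarrow> nat" where
  "zero_mult f z = (if z \<in> closure rhp \<and> f z = 0 then nat (zorder f z) else 0)"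

definition zero_sets :: "(complex \<Rightarrow> complex) set \<Rightarrow> (complex \<Rightarrow> nat) set" where
  "zero_sets K = {zero_mult f |f. f \<in> K \<and> (\<exists>z\<in>closure rhp. f z \<noteq> 0)}"

lemma closure_rhp: "closure rhp = {z. 0 \<le> Re z}"
proof -
  have "rhp = {z. inner 1 z > 0}" by (auto simp: rhp_def inner_complex_def)
  then have "closure rhp = {z. inner 1 z \<ge> (0::real)}"
    using closure_halfspace_gt[of "1::complex" 0] by simp
  then show ?thesis by (simp add: inner_complex_def)
qed

lemma bdry_ext_Hol_rhp:
  assumes "f \<in> Hol_rhp" "z \<in> closure rhp"
  shows "bdry_ext f z = f z"
proof -
  have "Lim (at_right 0) (\<lambda>x. f (Complex x (Im z))) = f z" if z: "Re z = 0"
  proof (rule tendsto_Lim)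
    have "isCont f z"
      using assms unfolding Hol_rhp_def
      by (metis analytic_at_imp_isCont analytic_on_analytic_at mem_Collect_eq)
    then have "f \<midarrow>z\<rightarrow> f z" by (simp add: isCont_def)
    moreover have "((\<lambda>x. Complex x (Im z)) \<longlongrightarrow> z) (at_right 0)"
    proof -
      have "((\<lambda>x. Complex x (Im z)) \<longlongrightarrow> Complex 0 (Im z)) (at_right 0)"
        by (intro tendsto_intros)
      then show ?thesis using z by (metis complex_surj)
    qed
    ultimately show "((\<lambda>x. f (Complex x (Im z))) \<longlongrightarrow> f z) (at_right 0)"
      using \<open>isCont f z\<close> isCont_tendsto_compose by blast
  qed simp
  then show ?thesis using assms(2) by (auto simp: bdry_ext_def closure_rhp)
qed

lemma nn_integral_omega:
  assumes g: "g \<in> borel_measurable borel"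
  shows "(\<integral>\<^sup>+z. g z \<partial>omega) =
    (\<Sum>n. ennreal (2 ^ n / fact n) * (\<integral>\<^sup>+y. g (Complex (real n / 2) y) \<partial>lborel))"
proof -
  have C: "(\<lambda>(x, y). Complex x y) \<in> borel_measurable (borel \<Otimes>\<^sub>M borel)"
    unfolding borel_prod case_prod_beta
    by (intro borel_measurable_continuous_onI continuous_intros)
  have C': "(\<lambda>(x, y). Complex x y) \<in> borel_measurable (nu \<Otimes>\<^sub>M lborel)"
    using C by (simp add: nu_def cong: measurable_cong_sets)
  have gC: "(\<lambda>(x, y). g (Complex x y)) \<in> borel_measurable (borel \<Otimes>\<^sub>M lborel)"
    using measurable_compose[OF C g] by (simp add: case_prod_beta cong: measurable_cong_sets)
  then have gn: "(\<lambda>(x, y). g (Complex x y)) \<in> borel_measurable (nu \<Otimes>\<^sub>M lborel)"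
    by (simp add: nu_def cong: measurable_cong_sets)
  have m: "(\<lambda>x. \<integral>\<^sup>+y. g (Complex x y) \<partial>lborel) \<in> borel_measurable borel"
    using lborel.borel_measurable_nn_integral[OF gC] .
  have "(\<integral>\<^sup>+z. g z \<partial>omega) = (\<integral>\<^sup>+p. (\<lambda>(x, y). g (Complex x y)) p \<partial>(nu \<Otimes>\<^sub>M lborel))"
    unfolding omega_def by (subst nn_integral_distr[OF C']) (use g in \<open>simp_all add: case_prod_beta'\<close>)
  also have "\<dots> = (\<integral>\<^sup>+x. \<integral>\<^sup>+y. g (Complex x y) \<partial>lborel \<partial>nu)"
    by (subst lborel.nn_integral_fst[OF gn, symmetric]) simp
  also have "\<dots> = (\<Sum>n. ennreal (2 ^ n / fact n) * (\<integral>\<^sup>+y. g (Complex (real n / 2) y) \<partial>lborel))"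
    unfolding nu_def
    by (subst nn_integral_distr) (use m in \<open>auto simp: nn_integral_density nn_integral_count_space_nat\<close>)
  finally show ?thesis .
qed

end

theory Submission imports Defs begin

text \<open>
  Multiplying a function by a zero-free one leaves its zero set unchanged, so for each inclusion it
  is enough to carry every function of the smaller class into the larger one by a zero-free factor.
  The weight $2^n/n!$ on the line $\Re z = n/2$ allows an $L^2$ norm of the size
  $\Gamma(n+1)^{1/2} 2^{-n/2} \approx \Gamma(1+n/2)$, and on vertical lines $\Gamma(1+z)$ decays
  like $e^{-\pi|\Im z|/2}$; this is where the type $\pi/2$ comes from. In the role of $\Gamma(1+z)$
  stands the main term $E(z) = (z+1)^{z+1}$ of Stirling's formula (\<^term>\<open>stirling_factor\<close>), whose
  modulus is explicit.

  If $g$ has exponential type less than $\pi/2$, then $g(z) E(z) e^{-cz}$ with $c$ large lies in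
  the weighted space: $E$ decays in $\Im z$ faster than $g$ grows
  (\<open>norm_stirling_factor_le\<close>), and $e^{-cz}$ makes the series over $n$ converge.

  Conversely, let $f$ be in the weighted space and holomorphic up to the imaginary axis. Away from
  the axis $f/E$ has type $\pi/2$: the line integrals control $f$ pointwise in between
  (\<open>strip_bound_from_edge_integrals\<close>), which gives $|f(z)| \le C (x+1)^{x+1}$ for
  $x = \Re z \ge 1/4$. On the axis, however, $f$ is merely continuous and square integrable and may
  have arbitrarily high narrow peaks. These are removed by an outer-type factor $e^{-L}$
  with $\Re L \ge 0$ and $\Re L(iy) \ge |f(iy)|^2$. Such an $L$, holomorphic across the axis, is a
  superposition of simple fractions $1/(z - p)$ with poles $p$ to the left of the axis, at a
  distance that shrinks with the oscillation of $|f|^2$; its total mass is comparable to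
  $\int |f(iy)|^2\,dy$ and therefore finite (\<open>exists_positive_real_part_majorant\<close>). Then
  $f e^{-L}$ is bounded near the axis by a Phragmen-Lindelof argument (\<open>bounded_near_axis\<close>), and
  $f e^{-L} / E$ has exponential type $\pi/2$ on the closed half-plane.
\<close>

section \<open>Pointwise bounds from integrals over vertical lines\<close>

lemma integral_le_of_nn_integral_le:
  fixes g :: "real \<Rightarrow> real"
  assumes "continuous_on {c..d} g" "\<And>y. 0 \<le> g y" "(\<integral>\<^sup>+y. ennreal (g y) \<partial>lborel) \<le> ennreal M" "0 \<le> M"
  shows "integral {c..d} g \<le> M"
proof -
  have "(g has_integral integral {c..d} g) {c..d}"
    by (intro integrable_integral integrable_continuous_real assms)
  from nn_integral_has_integral_lebesgue'[OF assms(2) this]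
  have "ennreal (integral {c..d} g) = (\<integral>\<^sup>+y. ennreal (g y) * indicator {c..d} y \<partial>lborel)"
    by simp
  also have "\<dots> \<le> (\<integral>\<^sup>+y. ennreal (g y) \<partial>lborel)"
    by (intro nn_integral_mono) (auto simp: indicator_def)
  also have "\<dots> \<le> ennreal M"
    by (rule assms)
  finally show ?thesis
    using assms(4) by simp
qed

text \<open>
  Young's inequality $|f| \<le> (1 + |f|^2)/2$ takes the place of Cauchy-Schwarz; the two
  agree when the line integral is 1, the case where the constant matters.
\<close>

lemma vertical_average_le:
  assumes "continuous_on UNIV (\<lambda>y. f (Complex (Re z) y))"
    and M: "(\<integral>\<^sup>+y. ennreal ((cmod (f (Complex (Re z) y)))\<^sup>2) \<partial>lborel) \<le> ennreal M" "0 \<le> M"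
    and h: "0 \<le> h" "h \<le> 1"
  shows "cmod (integral {0..h} (\<lambda>t. f (z + of_real t * \<i>))) \<le> (1 + M) / 2"
proof -
  define k where "k = (\<lambda>t. f (Complex (Re z) (Im z + t)))"
  have k: "(\<lambda>t. f (z + of_real t * \<i>)) = k"
  proof
    fix t
    have "z + of_real t * \<i> = Complex (Re z) (Im z + t)"
      by (simp add: complex_eq_iff)
    then show "f (z + of_real t * \<i>) = k t" by (simp add: k_def)
  qed
  have contk: "continuous_on A k" for A
    unfolding k_def
    by (rule continuous_on_compose2[OF assms(1), of A "\<lambda>t. Im z + t"]) (auto intro!: continuous_intros)
  have "(\<integral>\<^sup>+t. ennreal ((cmod (k t))\<^sup>2) \<partial>lborel) \<le> ennreal M"
  proof -
    have "(\<lambda>y. ennreal ((cmod (f (Complex (Re z) y)))\<^sup>2)) \<in> borel_measurable borel"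
      by (intro measurable_compose[OF _ measurable_ennreal] borel_measurable_continuous_onI
            continuous_intros assms)
    from nn_integral_real_affine[OF this, of 1 "Im z"] M show ?thesis
      by (simp add: k_def)
  qed
  then have sq: "integral {0..h} (\<lambda>t. (cmod (k t))\<^sup>2) \<le> M"
    by (intro integral_le_of_nn_integral_le continuous_intros contk M) auto
  have "cmod (integral {0..h} k) \<le> integral {0..h} (\<lambda>t. (1 + (cmod (k t))\<^sup>2) / 2)"
  proof (rule integral_norm_bound_integral)
    show "k integrable_on {0..h}" "(\<lambda>t. (1 + (cmod (k t))\<^sup>2) / 2) integrable_on {0..h}"
      by (intro integrable_continuous_real continuous_intros contk; simp)+
    show "cmod (k t) \<le> (1 + (cmod (k t))\<^sup>2) / 2" for t
      using sum_squares_bound[of 1 "cmod (k t)"] by simp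
  qed
  also have "\<dots> = (h + integral {0..h} (\<lambda>t. (cmod (k t))\<^sup>2)) / 2"
    using h by (subst integral_divide, subst integral_add)
      (auto intro!: integrable_continuous_real continuous_intros contk)
  also have "\<dots> \<le> (1 + M) / 2"
    using sq h by simp
  finally show ?thesis
    by (simp add: k)
qed

text \<open>
  Vertical averages of \<open>f\<close> are differences of a primitive, hence again holomorphic, and differences
  of \<open>f\<close> itself are their derivatives.
\<close>

lemma vertical_primitive:
  assumes "open S" "convex S" "f holomorphic_on S"
    and vert: "\<And>z t. z \<in> S \<Longrightarrow> z + of_real t * \<i> \<in> S"
  obtains \<Phi> where "\<And>z. z \<in> S \<Longrightarrow> (\<Phi> has_field_derivative f z) (at z)"
    and "\<And>z h. z \<in> S \<Longrightarrow> 0 \<le> h \<Longrightarrow>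
      ((\<lambda>t. f (z + of_real t * \<i>)) has_integral - \<i> * (\<Phi> (z + of_real h * \<i>) - \<Phi> z)) {0..h}"
proof -
  obtain \<Phi> where "\<And>z. z \<in> S \<Longrightarrow> (\<Phi> has_field_derivative f z) (at z within S)"
    using holomorphic_convex_primitive'[OF assms(2,1,3)] by blast
  then have \<Phi>: "\<And>z. z \<in> S \<Longrightarrow> (\<Phi> has_field_derivative f z) (at z)"
    using assms(1) by (simp add: at_within_open[of _ S])
  have "((\<lambda>t. f (z + of_real t * \<i>)) has_integral - \<i> * (\<Phi> (z + of_real h * \<i>) - \<Phi> z)) {0..h}"
    if z: "z \<in> S" and h: "0 \<le> h" for z h
  proof -
    have "((\<lambda>t. - \<i> * (\<Phi> (z + of_real t * \<i>))) has_vector_derivative f (z + of_real t * \<i>)) (at t within {0..h})"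
      for t :: real
    proof (rule has_vector_derivative_at_within)
      have "((\<lambda>t. z + of_real t * \<i>) has_vector_derivative \<i>) (at t)"
        by (auto intro!: derivative_eq_intros)
      from field_vector_diff_chain_at[OF this \<Phi>[OF vert[OF z]]]
      have "((\<lambda>t. \<Phi> (z + of_real t * \<i>)) has_vector_derivative (\<i> * f (z + of_real t * \<i>))) (at t)"
        by (simp add: o_def)
      from has_vector_derivative_mult_right[OF this, of "- \<i>"]
      show "((\<lambda>t. - \<i> * (\<Phi> (z + of_real t * \<i>))) has_vector_derivative f (z + of_real t * \<i>)) (at t)"
        by (simp add: mult.assoc[symmetric])
    qed
    from fundamental_theorem_of_calculus[OF h this] show ?thesis
      by (simp add: algebra_simps)
  qed
  with \<Phi> that show ?thesis by blast
qed

text \<open>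
  A substitute for the mean value property over discs that needs no integration in the plane:
  by Cauchy's inequality the derivative $f(z+ih) - f(z)$ of an average of length $h$ is at most
  $B/r$, so $f(z)$ differs from its average over $[z, z+i]$ by at most $B/r$.
\<close>

lemma bound_by_vertical_averages:
  assumes "open S" "convex S" "f holomorphic_on S"
    and vert: "\<And>z t. z \<in> S \<Longrightarrow> z + of_real t * \<i> \<in> S"
    and avg: "\<And>z h. z \<in> S \<Longrightarrow> 0 \<le> h \<Longrightarrow> h \<le> 1 \<Longrightarrow>
      cmod (integral {0..h} (\<lambda>t. f (z + of_real t * \<i>))) \<le> B"
    and r: "0 < r" "cball z r \<subseteq> S"
  shows "cmod (f z) \<le> B * (1 + 1 / r)"
proof -
  obtain \<Phi> where \<Phi>: "\<And>z. z \<in> S \<Longrightarrow> (\<Phi> has_field_derivative f z) (at z)"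
    and int: "\<And>z h. z \<in> S \<Longrightarrow> 0 \<le> h \<Longrightarrow>
      ((\<lambda>t. f (z + of_real t * \<i>)) has_integral - \<i> * (\<Phi> (z + of_real h * \<i>) - \<Phi> z)) {0..h}"
    using vertical_primitive[OF assms(1-3) vert] by blast
  have zS: "z \<in> S" using r by auto
  \<comment> \<open>Cauchy's inequality for the average \<open>\<Psi>\<close>, whose derivative is this difference.\<close>
  have diff: "cmod (f (z + of_real h * \<i>) - f z) \<le> B / r" if h: "0 \<le> h" "h \<le> 1" for h
  proof -
    define \<Psi> where "\<Psi> = (\<lambda>w. \<Phi> (w + of_real h * \<i>) - \<Phi> w)"
    have \<Psi>': "(\<Psi> has_field_derivative f (w + of_real h * \<i>) - f w) (at w)" if "w \<in> S" for w
    proof -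
      have "((\<lambda>w. \<Phi> (w + of_real h * \<i>)) has_field_derivative f (w + of_real h * \<i>)) (at w)"
        by (rule DERIV_shift[THEN iffD1]) (rule \<Phi>[OF vert[OF that]])
      then show ?thesis
        unfolding \<Psi>_def by (intro DERIV_diff \<Phi> that)
    qed
    have hol: "\<Psi> holomorphic_on S"
      using \<Psi>' \<open>open S\<close> by (auto simp: holomorphic_on_open)
    have "cmod (\<Psi> w) \<le> B" if "w \<in> S" for w
      using avg[OF that h] integral_unique[OF int[OF that h(1)]]
      by (simp add: \<Psi>_def norm_mult)
    then have "cmod ((deriv ^^ 1) \<Psi> z) \<le> fact 1 * B / r ^ 1"
      by (intro Cauchy_inequality holomorphic_on_subset[OF hol]
            continuous_on_subset[OF holomorphic_on_imp_continuous_on[OF hol]] r)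
         (use r in \<open>auto simp: dist_norm subset_iff\<close>)
    then show ?thesis
      using DERIV_imp_deriv[OF \<Psi>'[OF zS]] by simp
  qed
  have i1: "(\<lambda>t. f (z + of_real t * \<i>)) integrable_on {0..1}"
    using int[OF zS, of 1] by (auto simp: integrable_on_def)
  have i2: "(\<lambda>t::real. f z) integrable_on {0..1}"
    by (rule integrable_const_ivl)
  have "f z = integral {0..1} (\<lambda>t. f (z + of_real t * \<i>)) - integral {0..1} (\<lambda>t. f (z + of_real t * \<i>) - f z)"
    using i1 i2 by (subst integral_diff) auto
  also have "cmod \<dots> \<le> B + B / r"
  proof (rule order_trans[OF norm_triangle_ineq4 add_mono])
    show "cmod (integral {0..1} (\<lambda>t. f (z + of_real t * \<i>))) \<le> B"
      using avg[OF zS, of 1] by simp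
    show "cmod (integral {0..1} (\<lambda>t. f (z + of_real t * \<i>) - f z)) \<le> B / r"
      using integral_norm_bound_integral[OF integrable_diff[OF i1 i2] integrable_const_ivl[of "B / r"]]
        diff by simp
  qed
  finally show ?thesis
    by (simp add: algebra_simps)
qed

text \<open>
  A function in $H^2$ of a strip may blow up at the left edge, but not faster than $1/\Re z$. This
  is the growth hypothesis in \<open>strip_maximum_principle\<close>.
\<close>

lemma H2_mult_Re_bounded:
  assumes "f \<in> H2 b"
  obtains C where "\<And>z. 0 < Re z \<Longrightarrow> Re z \<le> b / 2 \<Longrightarrow> cmod (f z) * Re z \<le> C"
proof -
  define T where "T = (SUP x\<in>{0<..<b}. \<integral>\<^sup>+y. ennreal ((cmod (f (Complex x y)))\<^sup>2) \<partial>lborel)"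
  have hol: "f holomorphic_on strip b" and T: "T < \<infinity>"
    using assms by (auto simp: H2_def T_def)
  from T obtain M where M: "T = ennreal M" "0 \<le> M"
    by (cases T rule: ennreal_cases) auto
  have strip: "strip b = {z. inner 1 z > 0} \<inter> {z. inner 1 z < b}"
    by (auto simp: strip_def inner_complex_def)
  have op: "open (strip b)" and cv: "convex (strip b)"
    unfolding strip
    by (intro open_Int open_halfspace_gt open_halfspace_lt)
       (intro convex_Int convex_halfspace_gt convex_halfspace_lt)
  show ?thesis
  proof (rule that)
    fix z assume z: "0 < Re z" "Re z \<le> b / 2"
    have "cmod (f z) \<le> (1 + M) / 2 * (1 + 1 / (Re z / 2))"
    proof (rule bound_by_vertical_averages[OF op cv hol])
      show "w + of_real t * \<i> \<in> strip b" if "w \<in> strip b" for w t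
        using that by (auto simp: strip_def)
      show "cball z (Re z / 2) \<subseteq> strip b"
      proof
        fix w assume "w \<in> cball z (Re z / 2)"
        then have "\<bar>Re w - Re z\<bar> \<le> Re z / 2"
          using abs_Re_le_cmod[of "w - z"] by (simp add: dist_norm norm_minus_commute)
        then show "w \<in> strip b" using z unfolding strip_def mem_Collect_eq by linarith
      qed
      fix w h assume w: "w \<in> strip b" and h: "0 \<le> h" "h \<le> (1::real)"
      show "cmod (integral {0..h} (\<lambda>t. f (w + of_real t * \<i>))) \<le> (1 + M) / 2"
      proof (rule vertical_average_le[OF _ _ M(2) h])
        show "continuous_on UNIV (\<lambda>y. f (Complex (Re w) y))"
          using w by (intro continuous_on_compose2[OF holomorphic_on_imp_continuous_on[OF hol]])
            (auto simp: strip_def Complex_eq intro!: continuous_intros)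
        show "(\<integral>\<^sup>+ y. ennreal ((cmod (f (Complex (Re w) y)))\<^sup>2) \<partial>lborel) \<le> ennreal M"
          using w unfolding M(1)[symmetric] T_def by (intro SUP_upper) (auto simp: strip_def)
      qed
    qed (use z in auto)
    then have "cmod (f z) * Re z \<le> (1 + M) / 2 * (1 + 1 / (Re z / 2)) * Re z"
      using z by (intro mult_right_mono) auto
    also have "\<dots> = (1 + M) / 2 * (Re z + 2)"
      using z by (simp add: field_simps)
    also have "\<dots> \<le> (1 + M) / 2 * (b + 2)"
      using z M by (intro mult_left_mono) auto
    finally show "cmod (f z) * Re z \<le> (1 + M) / 2 * (b + 2)" .
  qed
qed

text \<open>
  A Phragmen-Lindelof principle that tolerates blow-up along the left edge: a bound
  $|f(z)| \le C/(\Re z - a)$ inside is compatible with unbounded values as $|\Im z|$ grows near that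
  edge. In terms of $u = z - a$, a parameter $e > 0$ and $Y = 1/e^2$, the auxiliary factor
  $m_e(u) = \frac{u^2 + Y^2}{(u+1)^2 + Y^2} \cdot \frac{1}{1 + eu}$
  vanishes at the corners $\pm iY$ of the rectangle $|\Im z| \le Y$ and so compensates the blow-up on the
  horizontal sides; the second fraction makes the product small there. As $e \to 0$ the factor tends
  to 1.
\<close>

lemma strip_maximum_principle:
  assumes ab: "a < b"
    and cont: "continuous_on {z. a \<le> Re z \<and> Re z \<le> b} f"
    and hol: "f holomorphic_on {z. a < Re z \<and> Re z < b}"
    and weak: "\<And>z. a < Re z \<Longrightarrow> Re z < b \<Longrightarrow> cmod (f z) * (Re z - a) \<le> C"
    and left: "\<And>z. Re z = a \<Longrightarrow> cmod (f z) \<le> B"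
    and right: "\<And>z. Re z = b \<Longrightarrow> cmod (f z) \<le> B"
    and B: "0 < B" and z: "a \<le> Re z" "Re z \<le> b"
  shows "cmod (f z) \<le> B"
proof -
  \<comment> \<open>\<open>p d u\<close> is $1 + d^2u^2$, with zeros at $\pm i/d$; below $d = e^2$, so that $Y = 1/d$.\<close>
  define p where "p = (\<lambda>d u::complex. (1 - \<i> * of_real d * u) * (1 + \<i> * of_real d * u))"
  define m where "m = (\<lambda>e u. p (e\<^sup>2) u / p (e\<^sup>2) (u + 1) / (1 + of_real e * u))"
  have nz: "cmod (1 + c * \<i> * of_real d * u) \<le> cmod (1 + c * \<i> * of_real d * (u + 1))"
      "1 + c * \<i> * of_real d * (u + 1) \<noteq> 0"
    if "d > 0" "0 \<le> Re u" "c = 1 \<or> c = -1" for d u and c :: complex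
  proof -
    have "(d * Re u)\<^sup>2 \<le> (d * (Re u + 1))\<^sup>2"
      using that by (intro power_mono mult_left_mono) auto
    then show "cmod (1 + c * \<i> * of_real d * u) \<le> cmod (1 + c * \<i> * of_real d * (u + 1))"
      using that(3) by (auto simp: cmod_def real_sqrt_le_iff power2_eq_square algebra_simps)
    have "d * (Re u + 1) > 0" using that by auto
    then show "1 + c * \<i> * of_real d * (u + 1) \<noteq> 0"
      using that(3) by (auto simp: complex_eq_iff algebra_simps)
  qed
  have nze: "1 \<le> cmod (1 + of_real e * u)" "\<bar>e * Im u\<bar> \<le> cmod (1 + of_real e * u)"
    if "e > 0" "0 \<le> Re u" for e u
  proof -
    have "0 \<le> e * Re u" using that by simp
    moreover have "1 + e * Re u \<le> cmod (1 + of_real e * u)"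
      using complex_Re_le_cmod[of "1 + of_real e * u"] by simp
    ultimately show "1 \<le> cmod (1 + of_real e * u)" by linarith
    show "\<bar>e * Im u\<bar> \<le> cmod (1 + of_real e * u)"
      using abs_Im_le_cmod[of "1 + of_real e * u"] by simp
  qed
  have p_le: "cmod (p d u) \<le> cmod (p d (u + 1))" "p d (u + 1) \<noteq> 0" if "d > 0" "0 \<le> Re u" for d u
    using nz[OF that, of 1] nz[OF that, of "-1"] unfolding p_def
    by (auto simp: norm_mult intro!: mult_mono)
  have m1: "cmod (m e u) \<le> 1" if "e > 0" "0 \<le> Re u" for e u
  proof -
    have "cmod (p (e\<^sup>2) u) / cmod (p (e\<^sup>2) (u + 1)) \<le> 1" "1 / cmod (1 + of_real e * u) \<le> 1"
      using p_le[of "e\<^sup>2" u] nze(1)[of e u] that by (auto simp: divide_le_eq)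
    from mult_mono[OF this] show ?thesis
      by (simp add: m_def norm_divide norm_mult)
  qed
  \<comment> \<open>On the horizontal sides the zero at the corner contributes \<open>Re u\<close>, the last fraction \<open>e\<close>.\<close>
  have m2: "cmod (m e u) \<le> Re u * e" if e: "e > 0" and u: "0 \<le> Re u" and Im: "\<bar>Im u\<bar> = 1 / e\<^sup>2" for e u
  proof -
    have *: "cmod (p d u) \<le> Re u * cmod (p d (u + 1))"
      if u: "0 \<le> Re u" and c: "c = 1 \<or> c = - 1" and d: "d > 0" "d * Im u = Re c" for u d and c :: complex
    proof -
      have sp: "p d w = (1 - c * \<i> * of_real d * w) * (1 + c * \<i> * of_real d * w)" for w
        using c by (auto simp: p_def)
      have e1: "1 + c * \<i> * of_real d * u = c * \<i> * of_real (d * Re u)"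
        using c d(2) by (auto simp: complex_eq_iff)
      have e2: "1 + c * \<i> * of_real d * (u + 1) = c * \<i> * of_real (d * (Re u + 1))"
        using c d(2) by (auto simp: complex_eq_iff algebra_simps)
      have "cmod (1 + c * \<i> * of_real d * u) = d * Re u"
        using c d u unfolding e1 by (auto simp: norm_mult)
      moreover have "cmod (1 + c * \<i> * of_real d * (u + 1)) = d * (Re u + 1)"
        using c d u unfolding e2 norm_mult norm_of_real by auto
      moreover have "d * Re u \<le> Re u * (d * (Re u + 1))"
        using u d by (simp add: algebra_simps)
      moreover have "cmod (1 - c * \<i> * of_real d * u) \<le> cmod (1 - c * \<i> * of_real d * (u + 1))"
        using nz(1)[OF d(1) u, of "- c"] c by auto
      ultimately have "cmod (1 - c * \<i> * of_real d * u) * cmod (1 + c * \<i> * of_real d * u)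
          \<le> cmod (1 - c * \<i> * of_real d * (u + 1)) * (Re u * cmod (1 + c * \<i> * of_real d * (u + 1)))"
        using u d by (intro mult_mono) auto
      then show ?thesis
        unfolding sp norm_mult by (simp add: mult_ac)
    qed
    have "cmod (p (e\<^sup>2) u) \<le> Re u * cmod (p (e\<^sup>2) (u + 1))"
    proof (cases "Im u \<ge> 0")
      case True
      then show ?thesis using *[OF u, of 1 "e\<^sup>2"] e Im by auto
    next
      case False
      then have "e\<^sup>2 * Im u = Re (-1)" using e Im by (auto simp: field_simps)
      then show ?thesis using *[OF u, of "-1" "e\<^sup>2"] e by auto
    qed
    then have 1: "cmod (p (e\<^sup>2) u) / cmod (p (e\<^sup>2) (u + 1)) \<le> Re u"
      using p_le(2)[of "e\<^sup>2" u] e u by (simp add: divide_le_eq)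
    have "\<bar>e * Im u\<bar> = 1 / e"
      using e Im by (simp add: abs_mult power2_eq_square)
    then have "1 / e \<le> cmod (1 + of_real e * u)"
      using nze(2)[OF e u] by simp
    then have 2: "1 / cmod (1 + of_real e * u) \<le> e"
      using e nze(1)[OF e u] by (subst pos_divide_le_eq) (auto simp: field_simps)
    from mult_mono[OF 1 2] u show ?thesis by (simp add: m_def norm_divide norm_mult)
  qed
  have key: "cmod (f z * m e (z - of_real a)) \<le> B"
    if e: "e > 0" "C * e \<le> B" "e\<^sup>2 * \<bar>Im z\<bar> \<le> 1" for e
  proof -
    define R where "R = cbox (Complex a (- 1 / e\<^sup>2)) (Complex b (1 / e\<^sup>2))"
    have inR: "w \<in> R \<longleftrightarrow> a \<le> Re w \<and> Re w \<le> b \<and> \<bar>Im w\<bar> \<le> 1 / e\<^sup>2" for w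
      by (auto simp: R_def in_cbox_complex_iff)
    have intR: "w \<in> interior R \<longleftrightarrow> a < Re w \<and> Re w < b \<and> \<bar>Im w\<bar> < 1 / e\<^sup>2" for w
      by (auto simp: R_def interior_cbox in_box_complex_iff)
    have "closure R = R" by (simp add: R_def)
    show ?thesis
    proof (rule maximum_modulus_frontier[where S = R and f = "\<lambda>w. f w * m e (w - of_real a)" and \<xi> = z])
      show "bounded R" by (simp add: R_def)
      show "z \<in> R" using z e by (auto simp: inR field_simps)
      have ne: "p (e\<^sup>2) (w - of_real a + 1) \<noteq> 0" "1 + of_real e * (w - of_real a) \<noteq> 0"
        if "a \<le> Re w" for w
        using p_le(2)[of "e\<^sup>2" "w - of_real a"] nze(1)[of e "w - of_real a"] that e by auto
      have "(\<lambda>w. m e (w - of_real a)) holomorphic_on {w. a \<le> Re w}"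
        using ne unfolding m_def p_def by (intro holomorphic_intros) (auto simp: p_def)
      note mhol = holomorphic_on_subset[OF this]
      show "(\<lambda>w. f w * m e (w - of_real a)) holomorphic_on interior R"
        by (intro holomorphic_on_mult holomorphic_on_subset[OF hol] mhol) (auto simp: intR)
      show "continuous_on (closure R) (\<lambda>w. f w * m e (w - of_real a))"
        unfolding \<open>closure R = R\<close>
        by (intro continuous_on_mult continuous_on_subset[OF cont] holomorphic_on_imp_continuous_on mhol)
           (auto simp: inR)
      fix w assume "w \<in> frontier R"
      then have w: "w \<in> R" "w \<notin> interior R"
        using \<open>closure R = R\<close> by (auto simp: frontier_def)
      then have w': "a \<le> Re w" "Re w \<le> b" "\<bar>Im w\<bar> \<le> 1 / e\<^sup>2" by (auto simp: inR)
      have m1': "cmod (m e (w - of_real a)) \<le> 1" using m1[OF e(1), of "w - of_real a"] w' by simp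
      show "cmod (f w * m e (w - of_real a)) \<le> B"
      proof (cases "Re w = a \<or> Re w = b")
        case True
        then have "cmod (f w) \<le> B" using left right by auto
        from mult_mono[OF this m1'] B show ?thesis by (simp add: norm_mult)
      next
        case False
        then have Im: "\<bar>Im w\<bar> = 1 / e\<^sup>2" and Re: "a < Re w" "Re w < b" using w w' unfolding intR by auto
        have "cmod (f w * m e (w - of_real a)) \<le> cmod (f w) * ((Re w - a) * e)"
          using m2[OF e(1), of "w - of_real a"] Im Re by (auto simp: norm_mult intro!: mult_left_mono)
        also have "\<dots> = cmod (f w) * (Re w - a) * e" by simp
        also have "\<dots> \<le> C * e" using weak[OF Re] e by (intro mult_right_mono) auto
        finally show ?thesis using e by simp
      qed
    qed
  qed
  have "((\<lambda>e. cmod (f z * m e (z - of_real a))) \<longlongrightarrow> cmod (f z * m 0 (z - of_real a))) (at_right 0)"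
    unfolding m_def p_def by (intro tendsto_intros) auto
  then have lim: "((\<lambda>e. cmod (f z * m e (z - of_real a))) \<longlongrightarrow> cmod (f z)) (at_right 0)"
    by (simp add: m_def p_def)
  have l1: "((\<lambda>e. C * e) \<longlongrightarrow> C * 0) (at_right 0)" and l2: "((\<lambda>e. e\<^sup>2 * \<bar>Im z\<bar>) \<longlongrightarrow> 0\<^sup>2 * \<bar>Im z\<bar>) (at_right (0::real))"
    by (intro tendsto_intros)+
  have "eventually (\<lambda>e. C * e < B) (at_right 0)"
    using order_tendstoD(2)[OF l1, of B] B by simp
  moreover have "eventually (\<lambda>e. e\<^sup>2 * \<bar>Im z\<bar> < 1) (at_right 0)"
    using order_tendstoD(2)[OF l2, of 1] by simp
  moreover have "eventually (\<lambda>e. e > (0::real)) (at_right 0)"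
    by (rule eventually_at_right_less)
  ultimately have "eventually (\<lambda>e. cmod (f z * m e (z - of_real a)) \<le> B) (at_right 0)"
    by eventually_elim (intro key; simp)
  from tendsto_upperbound[OF lim this] show ?thesis by simp
qed

text \<open>
  The vertical averages of \<open>f\<close> are bounded by 1 on the two edges, hence in the strip by the maximum
  principle; this bounds \<open>f\<close> at interior points. The maximum principle is applied to the averages and
  not to \<open>f\<close>, for \<open>f\<close> itself need not be bounded on the edges.
\<close>

lemma strip_bound_from_edge_integrals:
  assumes ab: "a < b"
    and cont: "continuous_on {z. a \<le> Re z \<and> Re z \<le> b} f"
    and hol: "f holomorphic_on {z. a < Re z \<and> Re z < b}"
    and weak: "\<And>z. a < Re z \<Longrightarrow> Re z < b \<Longrightarrow> cmod (f z) * (Re z - a) \<le> C"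
    and left: "(\<integral>\<^sup>+y. ennreal ((cmod (f (Complex a y)))\<^sup>2) \<partial>lborel) \<le> 1"
    and right: "(\<integral>\<^sup>+y. ennreal ((cmod (f (Complex b y)))\<^sup>2) \<partial>lborel) \<le> 1"
    and r: "0 < r" "a < Re z - r" "Re z + r < b"
  shows "cmod (f z) \<le> 1 + 1 / r"
proof -
  let ?S = "{z. a < Re z \<and> Re z < b}" and ?T = "{z. a \<le> Re z \<and> Re z \<le> b}"
  have strip: "?S = {z. inner 1 z > a} \<inter> {z. inner 1 z < b}"
    by (auto simp: inner_complex_def)
  have op: "open ?S" and cv: "convex ?S"
    unfolding strip
    by (intro open_Int open_halfspace_gt open_halfspace_lt)
       (intro convex_Int convex_halfspace_gt convex_halfspace_lt)
  have "cmod (f z) \<le> 1 * (1 + 1 / r)"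
  proof (rule bound_by_vertical_averages[OF op cv hol])
    show "cball z r \<subseteq> ?S"
    proof
      fix w assume "w \<in> cball z r"
      then have "\<bar>Re w - Re z\<bar> \<le> r"
        using abs_Re_le_cmod[of "w - z"] by (simp add: dist_norm norm_minus_commute)
      then show "w \<in> ?S" using r by auto
    qed
    fix w h assume w: "w \<in> ?S" and h: "0 \<le> h" "h \<le> (1::real)"
    obtain \<Phi> where \<Phi>: "\<And>z. z \<in> ?S \<Longrightarrow> (\<Phi> has_field_derivative f z) (at z)"
      and int: "\<And>z h. z \<in> ?S \<Longrightarrow> 0 \<le> h \<Longrightarrow>
        ((\<lambda>t. f (z + of_real t * \<i>)) has_integral - \<i> * (\<Phi> (z + of_real h * \<i>) - \<Phi> z)) {0..h}"
      by (rule vertical_primitive[OF op cv hol]) auto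
    have holP: "\<Phi> holomorphic_on ?S"
      using \<Phi> op by (auto simp: holomorphic_on_open)
    define F where "F = (\<lambda>z. integral {0..h} (\<lambda>t. f (z + of_real t * \<i>)))"
    have "cmod (F w) \<le> 1"
    proof (rule strip_maximum_principle[OF ab, where f = F and z = w])
      have "continuous_on (?T \<times> cbox 0 h) (\<lambda>(z, t). f (z + of_real t * \<i>))"
        unfolding case_prod_beta
        by (rule continuous_on_compose2[OF cont]) (auto intro!: continuous_intros)
      from integral_continuous_on_param[OF this] show "continuous_on ?T F"
        by (simp add: F_def)
      have "(\<lambda>z. - \<i> * (\<Phi> (z + of_real h * \<i>) - \<Phi> z)) holomorphic_on ?S"
        by (intro holomorphic_intros holP holomorphic_on_compose_gen[OF _ holP, unfolded o_def]) auto
      then show "F holomorphic_on ?S"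
        by (rule holomorphic_transform) (simp add: F_def integral_unique[OF int] h)
      show "cmod (F z) * (Re z - a) \<le> C" if z: "a < Re z" "Re z < b" for z
      proof -
        have C: "C \<ge> 0" using weak[OF z] z
          by (meson diff_gt_0_iff_gt less_imp_le mult_nonneg_nonneg norm_ge_zero order_trans)
        have "cmod (F z) \<le> C / (Re z - a) * (h - 0)"
          unfolding F_def
        proof (rule integral_bound[where f="\<lambda>t. f (z + of_real t * \<i>)"])
          show "continuous_on {0..h} (\<lambda>t. f (z + of_real t * \<i>))"
            using z by (intro continuous_on_compose2[OF cont]) (auto intro!: continuous_intros)
          show "cmod (f (z + of_real t * \<i>)) \<le> C / (Re z - a)" for t
            using weak[of "z + of_real t * \<i>"] z by (simp add: field_simps)
        qed (rule h)
        also have "\<dots> \<le> C / (Re z - a) * 1"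
          using h C z by (intro mult_left_mono) auto
        finally show ?thesis using z by (simp add: field_simps)
      qed
      have edge: "cmod (F z) \<le> 1"
        if z: "Re z = x" "x \<in> {a..b}" and "(\<integral>\<^sup>+y. ennreal ((cmod (f (Complex x y)))\<^sup>2) \<partial>lborel) \<le> 1" for z x
      proof -
        have "cmod (F z) \<le> (1 + 1) / 2"
          unfolding F_def
        proof (rule vertical_average_le[OF _ _ _ h])
          show "continuous_on UNIV (\<lambda>y. f (Complex (Re z) y))"
            using z by (intro continuous_on_compose2[OF cont])
              (auto simp: Complex_eq intro!: continuous_intros)
        qed (use that in auto)
        then show ?thesis by simp
      qed
      show "cmod (F z) \<le> 1" if "Re z = a" for z using edge[OF that _ left] ab by simp
      show "cmod (F z) \<le> 1" if "Re z = b" for z using edge[OF that _ right] ab by simp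
    qed (use w in auto)
    then show "cmod (integral {0..h} (\<lambda>t. f (w + of_real t * \<i>))) \<le> 1"
      by (simp add: F_def)
  qed (use r in auto)
  then show ?thesis by simp
qed

section \<open>Holomorphic functions with large real part on the imaginary axis\<close>

text \<open>
  The building block for heights in $[n, n+1]$ (and, by symmetry, $[-n-1, -n]$). Put poles at
  distance $d$ to the left of the axis, with $d$ so small that \<open>h\<close> varies by at most $\epsilon$ over
  this distance. On the
  axis, the real part of $1/(z - p)$ is at least $1/(2d)$ up to height difference $d$, so a density
  $2(h + \epsilon)$ of poles produces at least \<open>h\<close>. The last bound expresses that the block is small far
  from its poles, in proportion to its mass.
\<close>

lemma block_majorant:
  fixes h :: "real \<Rightarrow> real" and n :: nat
  assumes cont: "continuous_on {real n..real n + 1} h" and h: "\<And>t. 0 \<le> h t" and \<epsilon>: "0 < \<epsilon>"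
  obtains L where "L analytic_on {z. 0 \<le> Re z}" "L holomorphic_on {z. \<bar>Im z\<bar> < n}"
    and "\<And>z. 0 \<le> Re z \<Longrightarrow> 0 \<le> Re (L z)"
    and "\<And>y. real n \<le> \<bar>y\<bar> \<Longrightarrow> \<bar>y\<bar> \<le> real n + 1 \<Longrightarrow> h \<bar>y\<bar> \<le> Re (L (Complex 0 y))"
    and "\<And>z. \<bar>Im z\<bar> + 1 \<le> n \<Longrightarrow> cmod (L z) \<le> 4 * (integral {real n..real n + 1} h + \<epsilon>)"
proof -
  let ?I = "{real n..real n + 1}"
  have "uniformly_continuous_on ?I h"
    by (rule compact_uniformly_continuous[OF cont]) simp
  then obtain d0 where d0: "d0 > 0" "\<And>s t. s \<in> ?I \<Longrightarrow> t \<in> ?I \<Longrightarrow> dist t s < d0 \<Longrightarrow> dist (h t) (h s) < \<epsilon>"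
    unfolding uniformly_continuous_on_def using \<epsilon> by metis
  define d where "d = min (d0 / 2) (1 / 2)"
  have d: "0 < d" "d \<le> 1 / 2" using d0 by (auto simp: d_def)
  have osc: "h s \<le> h t + \<epsilon>" if "s \<in> ?I" "t \<in> ?I" "\<bar>s - t\<bar> \<le> d" for s t
  proof -
    have "dist t s < d0" using that(3) d0(1) unfolding dist_real_def d_def by linarith
    from d0(2)[OF that(1,2) this] show ?thesis by (auto simp: dist_real_def)
  qed
  define w where "w = (\<lambda>t. 2 * (h t + \<epsilon>))"
  define K where "K = (\<lambda>z t. 1 / (z + of_real d - \<i> * of_real t) + 1 / (z + of_real d + \<i> * of_real t))"
  define L where "L = (\<lambda>z. integral (cbox (real n) (real n + 1)) (\<lambda>t. of_real (w t) * K z t))"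
  have contw: "continuous_on ?I w"
    unfolding w_def by (intro continuous_intros cont)
  have w0: "0 \<le> w t" for t
    using h[of t] \<epsilon> by (simp add: w_def)
  have contwK: "continuous_on ?I (\<lambda>t. of_real (w t) * K z t)"
    if "\<And>t. t \<in> ?I \<Longrightarrow> z + of_real d - \<i> * of_real t \<noteq> 0 \<and> z + of_real d + \<i> * of_real t \<noteq> 0" for z
    using that unfolding K_def by (auto intro!: continuous_intros contw)
  have hol: "L holomorphic_on U"
    if "convex U" and
      ne: "\<And>z t. z \<in> U \<Longrightarrow> t \<in> ?I \<Longrightarrow> z + of_real d - \<i> * of_real t \<noteq> 0 \<and> z + of_real d + \<i> * of_real t \<noteq> 0"
    for U
    unfolding L_def
  proof (rule leibniz_rule_holomorphic)
    let ?K' = "\<lambda>z t. of_real (w t) * (- 1 / (z + of_real d - \<i> * of_real t)\<^sup>2 - 1 / (z + of_real d + \<i> * of_real t)\<^sup>2)"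
    fix z t assume z: "z \<in> U"
    show "((\<lambda>z. of_real (w t) * K z t) has_field_derivative ?K' z t) (at z within U)"
      if "t \<in> cbox (real n) (real n + 1)"
      using ne[OF z] that unfolding K_def
      by (auto intro!: derivative_eq_intros simp: power2_eq_square field_simps)
    show "(\<lambda>t. of_real (w t) * K z t) integrable_on cbox (real n) (real n + 1)"
      using contwK[OF ne[OF z]] by (auto intro: integrable_continuous_real)
  next
    show "continuous_on (U \<times> cbox (real n) (real n + 1)) (\<lambda>(z, t). of_real (w t) *
        (- 1 / (z + of_real d - \<i> * of_real t)\<^sup>2 - 1 / (z + of_real d + \<i> * of_real t)\<^sup>2))"
      unfolding case_prod_beta
      using ne by (auto intro!: continuous_intros continuous_on_compose2[OF contw])
  qed fact
  have ReK: "0 \<le> Re (K z t)" "d / (d\<^sup>2 + (\<bar>Im z\<bar> - t)\<^sup>2) \<le> Re (K z t) \<or> Re z \<noteq> 0"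
    if z: "0 \<le> Re z" and t: "t \<in> ?I" for z t
  proof -
    have eq: "Re (K z t) = (Re z + d) / ((Re z + d)\<^sup>2 + (Im z - t)\<^sup>2) + (Re z + d) / ((Re z + d)\<^sup>2 + (Im z + t)\<^sup>2)"
      by (simp add: K_def Re_divide)
    have 1: "0 \<le> (Re z + d) / ((Re z + d)\<^sup>2 + (Im z - t)\<^sup>2)" "0 \<le> (Re z + d) / ((Re z + d)\<^sup>2 + (Im z + t)\<^sup>2)"
      using z d by auto
    then show "0 \<le> Re (K z t)" unfolding eq by linarith
    have "(- Im z - t)\<^sup>2 = (Im z + t)\<^sup>2" by (simp add: power2_eq_square algebra_simps)
    then show "d / (d\<^sup>2 + (\<bar>Im z\<bar> - t)\<^sup>2) \<le> Re (K z t) \<or> Re z \<noteq> 0"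
      using 1 unfolding eq by (cases "Im z \<ge> 0") auto
  qed
  have neR: "z + of_real d - \<i> * of_real t \<noteq> 0 \<and> z + of_real d + \<i> * of_real t \<noteq> 0" if "- d < Re z" for z t
    using that by (auto simp: complex_eq_iff)
  have neI: "z + of_real d - \<i> * of_real t \<noteq> 0 \<and> z + of_real d + \<i> * of_real t \<noteq> 0"
    if "\<bar>Im z\<bar> < n" "t \<in> ?I" for z t
    using that by (auto simp: complex_eq_iff)
  have ReL: "Re (L z) = integral ?I (\<lambda>t. w t * Re (K z t))"
    and intRe: "(\<lambda>t. w t * Re (K z t)) integrable_on ?I" if z: "0 \<le> Re z" for z
  proof -
    have "(\<lambda>t. of_real (w t) * K z t) integrable_on ?I"
      using z d by (intro integrable_continuous_real contwK neR) auto
    then have "((\<lambda>t. of_real (w t) * K z t) has_integral L z) ?I"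
      by (auto simp: L_def)
    from has_integral_linear[OF this bounded_linear_Re]
    have "((\<lambda>t. w t * Re (K z t)) has_integral Re (L z)) ?I"
      by (simp add: o_def)
    then show "Re (L z) = integral ?I (\<lambda>t. w t * Re (K z t))" "(\<lambda>t. w t * Re (K z t)) integrable_on ?I"
      by (auto simp: has_integral_iff)
  qed
  show ?thesis
  proof (rule that)
    have R: "{z. - d < Re z} = {z. inner 1 z > - d}" by (auto simp: inner_complex_def)
    have "convex {z. - d < Re z}" "open {z. - d < Re z}"
      unfolding R by (rule convex_halfspace_gt, rule open_halfspace_gt)
    moreover from this have "L holomorphic_on {z. - d < Re z}"
      by (intro hol neR) auto
    ultimately have "L analytic_on {z. - d < Re z}"
      by (simp add: analytic_on_open)
    then show "L analytic_on {z. 0 \<le> Re z}"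
      by (rule analytic_on_subset) (use d in auto)
    have I: "{z. \<bar>Im z\<bar> < n} = {z. inner \<i> z > - n} \<inter> {z. inner \<i> z < n}"
      by (auto simp: inner_complex_def)
    have "convex {z. \<bar>Im z\<bar> < n}"
      unfolding I by (intro convex_Int convex_halfspace_gt convex_halfspace_lt)
    then show "L holomorphic_on {z. \<bar>Im z\<bar> < n}"
      by (rule hol) (use neI in auto)
    show "0 \<le> Re (L z)" if "0 \<le> Re z" for z
      unfolding ReL[OF that] by (intro integral_nonneg intRe that mult_nonneg_nonneg w0 ReK)
  next
    fix y :: real assume y: "real n \<le> \<bar>y\<bar>" "\<bar>y\<bar> \<le> real n + 1"
    \<comment> \<open>\<open>[s, s + d]\<close> is an interval of length \<open>d\<close> within the block that has \<open>\<bar>y\<bar>\<close> as an end point.\<close>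
    define s where "s = (if \<bar>y\<bar> + d \<le> n + 1 then \<bar>y\<bar> else \<bar>y\<bar> - d)"
    have sub: "{s..s + d} \<subseteq> ?I" using y d by (auto simp: s_def)
    have near: "\<bar>\<bar>y\<bar> - t\<bar> \<le> d" if "t \<in> {s..s + d}" for t
      using that d by (auto simp: s_def split: if_splits)
    have pt: "h \<bar>y\<bar> / d \<le> w t * Re (K (Complex 0 y) t)" if t: "t \<in> {s..s + d}" for t
    proof -
      have "(\<bar>y\<bar> - t)\<^sup>2 \<le> d\<^sup>2"
        using near[OF t] d by (metis abs_le_square_iff abs_of_pos)
      then have "d / (2 * d\<^sup>2) \<le> d / (d\<^sup>2 + (\<bar>y\<bar> - t)\<^sup>2)"
        using d by (intro divide_left_mono) (auto intro!: mult_pos_pos add_pos_nonneg)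
      also have "\<dots> \<le> Re (K (Complex 0 y) t)"
        using ReK(2)[of "Complex 0 y" t] t sub by auto
      finally have 1: "1 / (2 * d) \<le> Re (K (Complex 0 y) t)"
        using d by (simp add: power2_eq_square)
      have 2: "2 * h \<bar>y\<bar> \<le> w t"
        using osc[of "\<bar>y\<bar>" t] near[OF t] t sub y by (auto simp: w_def)
      have "2 * h \<bar>y\<bar> * (1 / (2 * d)) \<le> w t * Re (K (Complex 0 y) t)"
        using 1 2 h[of "\<bar>y\<bar>"] d w0[of t] by (intro mult_mono) auto
      then show ?thesis by simp
    qed
    have int: "(\<lambda>t. w t * Re (K (Complex 0 y) t)) integrable_on ?I"
      by (rule intRe) simp
    have int': "(\<lambda>t. w t * Re (K (Complex 0 y) t)) integrable_on {s..s + d}"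
      by (rule integrable_on_subinterval[OF int sub])
    have "h \<bar>y\<bar> = integral {s..s + d} (\<lambda>t. h \<bar>y\<bar> / d)"
      using d by simp
    also have "\<dots> \<le> integral {s..s + d} (\<lambda>t. w t * Re (K (Complex 0 y) t))"
      by (rule integral_le[OF _ int']) (use pt in auto)
    also have "\<dots> \<le> integral ?I (\<lambda>t. w t * Re (K (Complex 0 y) t))"
      by (rule integral_subset_le[OF sub int' int]) (auto intro!: mult_nonneg_nonneg w0 ReK)
    also have "\<dots> = Re (L (Complex 0 y))"
      by (subst ReL) auto
    finally show "h \<bar>y\<bar> \<le> Re (L (Complex 0 y))" .
  next
    fix z assume z: "\<bar>Im z\<bar> + 1 \<le> n"
    have Kle: "cmod (K z t) \<le> 2" if t: "t \<in> ?I" for t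
    proof -
      have "1 \<le> \<bar>Im (z + of_real d - \<i> * of_real t)\<bar>" "1 \<le> \<bar>Im (z + of_real d + \<i> * of_real t)\<bar>"
        using z t by auto
      then have "1 \<le> cmod (z + of_real d - \<i> * of_real t)" "1 \<le> cmod (z + of_real d + \<i> * of_real t)"
        using abs_Im_le_cmod order_trans by blast+
      then have "1 / cmod (z + of_real d - \<i> * of_real t) \<le> 1" "1 / cmod (z + of_real d + \<i> * of_real t) \<le> 1"
        by (auto intro: divide_le_eq_1[THEN iffD2])
      then show ?thesis
        unfolding K_def by (intro norm_triangle_le) (simp add: norm_divide)
    qed
    have "cmod (L z) \<le> integral ?I (\<lambda>t. w t * 2)"
      unfolding L_def cbox_interval
    proof (rule integral_norm_bound_integral)
      show "(\<lambda>t. of_real (w t) * K z t) integrable_on ?I"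
        using z by (intro integrable_continuous_real contwK neI) auto
      show "(\<lambda>t. w t * 2) integrable_on ?I"
        by (intro integrable_continuous_real continuous_intros contw)
      show "cmod (of_real (w t) * K z t) \<le> w t * 2" if "t \<in> ?I" for t
        using mult_left_mono[OF Kle[OF that] w0[of t]] w0[of t] by (simp add: norm_mult)
    qed
    also have "\<dots> = 4 * (integral {real n..real n + 1} h + \<epsilon>)"
    proof -
      have "integral ?I (\<lambda>t. h t + \<epsilon>) = integral ?I h + \<epsilon>"
        by (subst integral_add) (auto intro!: integrable_continuous_real cont)
      then have "integral ?I (\<lambda>t. 4 * (h t + \<epsilon>)) = 4 * (integral ?I h + \<epsilon>)"
        by (subst integral_mult_right) simp
      moreover have "(\<lambda>t. w t * 2) = (\<lambda>t. 4 * (h t + \<epsilon>))"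
        by (auto simp: w_def fun_eq_iff)
      ultimately show ?thesis by simp
    qed
    finally show "cmod (L z) \<le> 4 * (integral {real n..real n + 1} h + \<epsilon>)" .
  qed
qed

text \<open>
  Sum the blocks with $\epsilon = 2^{-n}$. Their masses form a convergent series because \<open>h\<close> is
  integrable, and near a given point all but finitely many blocks have their poles far away, so the
  series converges uniformly there. The blocks are symmetric under $y \mapsto -y$, hence the even
  majorant \<open>h1\<close>.
\<close>

lemma exists_positive_real_part_majorant:
  fixes h :: "real \<Rightarrow> real"
  assumes cont: "continuous_on UNIV h" and h: "\<And>y. 0 \<le> h y"
    and fin: "(\<integral>\<^sup>+y. ennreal (h y) \<partial>lborel) < \<infinity>"
  obtains L where "L analytic_on {z. 0 \<le> Re z}" "\<And>z. 0 \<le> Re z \<Longrightarrow> 0 \<le> Re (L z)"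
    and "\<And>y. h y \<le> Re (L (Complex 0 y))"
proof -
  define h1 where "h1 = (\<lambda>y. h y + h (- y))"
  have cont1: "continuous_on A h1" for A
    unfolding h1_def
    by (intro continuous_intros continuous_on_subset[OF cont] continuous_on_compose2[OF cont]) auto
  have h1: "0 \<le> h1 y" for y using h[of y] h[of "- y"] by (simp add: h1_def)
  have "(\<integral>\<^sup>+y. ennreal (h1 y) \<partial>lborel) < \<infinity>"
  proof -
    have m: "h \<in> borel_measurable borel" by (rule borel_measurable_continuous_onI[OF cont])
    have "(\<integral>\<^sup>+y. ennreal (h (0 + (- 1) * y)) \<partial>lborel) = (\<integral>\<^sup>+y. ennreal (h y) \<partial>lborel)"
      using nn_integral_real_affine[of "\<lambda>y. ennreal (h y)" "- 1" 0] m by simp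
    then have "(\<integral>\<^sup>+y. ennreal (h1 y) \<partial>lborel) = (\<integral>\<^sup>+y. ennreal (h y) \<partial>lborel) + (\<integral>\<^sup>+y. ennreal (h y) \<partial>lborel)"
      using m h unfolding h1_def by (simp add: ennreal_plus nn_integral_add)
    with fin show ?thesis by (simp add: ennreal_add_less_top)
  qed
  then obtain M where M: "(\<integral>\<^sup>+y. ennreal (h1 y) \<partial>lborel) \<le> ennreal M" "0 \<le> M"
    by (cases "\<integral>\<^sup>+y. ennreal (h1 y) \<partial>lborel" rule: ennreal_cases) auto
  define a where "a = (\<lambda>n. integral {real n..real n + 1} h1)"
  have a0: "0 \<le> a n" for n
    unfolding a_def by (intro integral_nonneg integrable_continuous_real cont1 h1)
  have "(\<Sum>n<N. a n) = integral {0..real N} h1" for N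
  proof (induction N)
    case (Suc N)
    have "integral {0..real N} h1 + integral {real N..real (Suc N)} h1 = integral {0..real (Suc N)} h1"
      by (intro Henstock_Kurzweil_Integration.integral_combine integrable_continuous_real cont1) auto
    with Suc show ?case by (simp add: a_def add.commute)
  qed simp
  also have "integral {0..real N} h1 \<le> M" for N
    by (intro integral_le_of_nn_integral_le cont1 h1 M)
  finally have suma: "summable a"
    using a0 by (intro summableI_nonneg_bounded[of _ M]) auto
  define b where "b = (\<lambda>n. 4 * (a n + (1 / 2) ^ n))"
  have sumb: "summable b"
    unfolding b_def by (intro summable_mult summable_add suma summable_geometric) simp
  have "\<exists>L. L analytic_on {z. 0 \<le> Re z} \<and> L holomorphic_on {z. \<bar>Im z\<bar> < n} \<and>
      (\<forall>z. 0 \<le> Re z \<longrightarrow> 0 \<le> Re (L z)) \<and>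
      (\<forall>y. real n \<le> \<bar>y\<bar> \<longrightarrow> \<bar>y\<bar> \<le> real n + 1 \<longrightarrow> h1 \<bar>y\<bar> \<le> Re (L (Complex 0 y))) \<and>
      (\<forall>z. \<bar>Im z\<bar> + 1 \<le> n \<longrightarrow> cmod (L z) \<le> b n)" for n :: nat
  proof -
    have pos: "(0::real) < (1 / 2) ^ n" by simp
    obtain L where "L analytic_on {z. 0 \<le> Re z}" "L holomorphic_on {z. \<bar>Im z\<bar> < n}"
      and "\<And>z. 0 \<le> Re z \<Longrightarrow> 0 \<le> Re (L z)"
      and "\<And>y. real n \<le> \<bar>y\<bar> \<Longrightarrow> \<bar>y\<bar> \<le> real n + 1 \<Longrightarrow> h1 \<bar>y\<bar> \<le> Re (L (Complex 0 y))"
      and "\<And>z. \<bar>Im z\<bar> + 1 \<le> n \<Longrightarrow> cmod (L z) \<le> 4 * (integral {real n..real n + 1} h1 + (1 / 2) ^ n)"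
      by (rule block_majorant[OF cont1 h1 pos, of n]) (rule that; assumption)
    then show ?thesis
      by (intro exI[of _ L] conjI allI impI) (auto simp: b_def a_def)
  qed
  then obtain L where ana: "\<And>n. L n analytic_on {z. 0 \<le> Re z}"
    and hol: "\<And>n. L n holomorphic_on {z. \<bar>Im z\<bar> < real n}"
    and pos: "\<And>n z. 0 \<le> Re z \<Longrightarrow> 0 \<le> Re (L n z)"
    and maj: "\<And>n y. real n \<le> \<bar>y\<bar> \<Longrightarrow> \<bar>y\<bar> \<le> real n + 1 \<Longrightarrow> h1 \<bar>y\<bar> \<le> Re (L n (Complex 0 y))"
    and bnd: "\<And>n z. \<bar>Im z\<bar> + 1 \<le> real n \<Longrightarrow> cmod (L n z) \<le> b n"
    by metis
  have sumL: "summable (\<lambda>n. L n z)" for z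
  proof (rule summable_comparison_test_ev[OF _ sumb])
    have "eventually (\<lambda>n. \<bar>Im z\<bar> + 1 \<le> real n) sequentially"
      by real_asymp
    then show "eventually (\<lambda>n. cmod (L n z) \<le> b n) sequentially"
      by eventually_elim (rule bnd)
  qed
  show ?thesis
  proof (rule that)
    show "(\<lambda>z. \<Sum>n. L n z) analytic_on {z. 0 \<le> Re z}"
    proof (subst analytic_on_analytic_at, intro ballI)
      fix z0 assume "z0 \<in> {z. 0 \<le> Re z}"
      then have z0: "0 \<le> Re z0" by simp
      obtain m :: nat where m: "\<bar>Im z0\<bar> < m" using reals_Archimedean2 by blast
      define V where "V = {z. \<bar>Im z\<bar> < m}"
      have V: "open V" "z0 \<in> V"
      proof -
        have "V = {z. inner \<i> z > - m} \<inter> {z. inner \<i> z < m}"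
          by (auto simp: V_def inner_complex_def)
        then show "open V"
          by (simp only: open_Int open_halfspace_gt open_halfspace_lt)
      qed (use m in \<open>simp add: V_def\<close>)
      have "(\<lambda>z. \<Sum>k. L (k + Suc m) z) holomorphic_on V"
      proof (rule holomorphic_uniform_sequence[OF V(1)])
        show "(\<lambda>z. \<Sum>k<N. L (k + Suc m) z) holomorphic_on V" for N
          by (intro holomorphic_on_sum holomorphic_on_subset[OF hol]) (auto simp: V_def)
        have ul: "uniform_limit V (\<lambda>N z. \<Sum>k<N. L (k + Suc m) z) (\<lambda>z. \<Sum>k. L (k + Suc m) z) sequentially"
        proof (rule Weierstrass_m_test)
          show "cmod (L (k + Suc m) z) \<le> b (k + Suc m)" if "z \<in> V" for k z
            using that by (intro bnd) (auto simp: V_def)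
          show "summable (\<lambda>k. b (k + Suc m))"
            using sumb by (subst summable_iff_shift)
        qed
        show "\<exists>d>0. cball z d \<subseteq> V \<and> uniform_limit (cball z d)
            (\<lambda>N z. \<Sum>k<N. L (k + Suc m) z) (\<lambda>z. \<Sum>k. L (k + Suc m) z) sequentially" if "z \<in> V" for z
          using open_contains_cball[THEN iffD1, OF V(1)] that uniform_limit_on_subset[OF ul] by blast
      qed
      then have "(\<lambda>z. \<Sum>k. L (k + Suc m) z) analytic_on {z0}"
        using V analytic_at by blast
      moreover have "(\<lambda>z. \<Sum>n<Suc m. L n z) analytic_on {z0}"
        by (intro analytic_on_sum analytic_on_subset[OF ana]) (use z0 in auto)
      ultimately have "(\<lambda>z. (\<Sum>k. L (k + Suc m) z) + (\<Sum>n<Suc m. L n z)) analytic_on {z0}"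
        by (rule analytic_on_add)
      moreover have "(\<Sum>n. L n z) = (\<Sum>k. L (k + Suc m) z) + (\<Sum>n<Suc m. L n z)" for z
        by (rule suminf_split_initial_segment[OF sumL])
      ultimately show "(\<lambda>z. \<Sum>n. L n z) analytic_on {z0}"
        by simp
    qed
    have ReL: "Re (\<Sum>n. L n z) = (\<Sum>n. Re (L n z))" and sumRe: "summable (\<lambda>n. Re (L n z))" for z
      using sumL[of z] by (auto intro: Re_suminf summable_Re)
    show "0 \<le> Re (\<Sum>n. L n z)" if "0 \<le> Re z" for z
      unfolding ReL by (intro suminf_nonneg sumRe pos that)
    fix y :: real
    define n where "n = nat \<lfloor>\<bar>y\<bar>\<rfloor>"
    have "h y \<le> h1 \<bar>y\<bar>" using h[of y] h[of "- y"] by (auto simp: h1_def abs_real_def)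
    also have "\<dots> \<le> Re (L n (Complex 0 y))"
      by (rule maj) (auto simp: n_def)
    also have "\<dots> = (\<Sum>k\<in>{n}. Re (L k (Complex 0 y)))" by simp
    also have "\<dots> \<le> (\<Sum>k. Re (L k (Complex 0 y)))"
      by (intro sum_le_suminf sumRe) (auto intro: pos)
    finally show "h y \<le> Re (\<Sum>n. L n (Complex 0 y))"
      by (simp add: ReL)
  qed
qed

section \<open>A zero-free factor with the growth of the Gamma function\<close>

definition stirling_factor :: "complex \<Rightarrow> complex" where
  "stirling_factor z = exp ((z + 1) * Ln (z + 1))"

lemma stirling_factor_analytic: "stirling_factor analytic_on {z. 0 \<le> Re z}"
  unfolding stirling_factor_def[abs_def]
  by (intro analytic_intros) (auto simp: complex_nonpos_Reals_iff)

lemma norm_stirling_factor: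
  assumes "0 \<le> Re z"
  defines "s \<equiv> Re z + 1"
  shows "cmod (stirling_factor z) = 
    exp (s * (ln s + ln (1 + (\<bar>Im z\<bar> / s)\<^sup>2) / 2) - \<bar>Im z\<bar> * arctan (\<bar>Im z\<bar> / s))"
proof -
  have s: "0 < s" and nz: "z + 1 \<noteq> 0"
    using assms by (auto simp: complex_eq_iff)
  have Re: "Re (Ln (z + 1)) = ln (cmod (z + 1))"
    using nz by simp
  have "s\<^sup>2 + (Im z)\<^sup>2 = s\<^sup>2 * (1 + (\<bar>Im z\<bar> / s)\<^sup>2)"
    using s by (simp add: field_simps)
  then have "cmod (z + 1) = s * sqrt (1 + (\<bar>Im z\<bar> / s)\<^sup>2)"
    using s by (simp add: cmod_def s_def[symmetric] real_sqrt_mult)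
  moreover have "0 < 1 + (\<bar>Im z\<bar> / s)\<^sup>2" by (simp add: add_pos_nonneg)
  ultimately have ln: "ln (cmod (z + 1)) = ln s + ln (1 + (\<bar>Im z\<bar> / s)\<^sup>2) / 2"
    using s by (simp add: ln_mult ln_sqrt)
  have "Im (Ln (z + 1)) = arctan (Im z / s)"
    using s nz by (simp add: Im_Ln_eq s_def)
  then have Im: "Im z * Im (Ln (z + 1)) = \<bar>Im z\<bar> * arctan (\<bar>Im z\<bar> / s)"
    by (cases "0 \<le> Im z") (auto simp: arctan_minus)
  show ?thesis
    unfolding stirling_factor_def norm_exp_eq_Re
    using Im by (simp add: Re ln s_def)
qed

text \<open>
  Dropping the logarithm and bounding the arctangent by $\pi/2$ already gives the exact type.
\<close>

lemma norm_stirling_factor_ge: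
  assumes "0 \<le> Re z"
  shows "exp ((Re z + 1) * ln (Re z + 1) - pi / 2 * \<bar>Im z\<bar>) \<le> cmod (stirling_factor z)"
proof -
  have "0 \<le> (Re z + 1) * (ln (1 + (\<bar>Im z\<bar> / (Re z + 1))\<^sup>2) / 2)"
    using assms by simp
  moreover have "\<bar>Im z\<bar> * arctan (\<bar>Im z\<bar> / (Re z + 1)) \<le> \<bar>Im z\<bar> * (pi / 2)"
    using arctan_ubound by (intro mult_left_mono) (auto simp: less_imp_le)
  ultimately show ?thesis
    unfolding norm_stirling_factor[OF assms] distrib_left[of "Re z + 1"] exp_le_cancel_iff
    by (simp only: mult.commute[of "pi / 2"])
qed

text \<open>
  With $s = \Re z + 1$ and $u = |\Im z|/s$, the exponent of $|E(z)|$ exceeds $s \ln s - \tau|\Im z|$ by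
  $s \phi(u)$ with $\phi(u) = \frac12 \ln(1+u^2) - (\arctan u - \tau) u$. Since $\arctan u \to \pi/2 > \tau$,
  the linear term wins over the logarithm and $\phi$ is bounded above.
\<close>

lemma norm_stirling_factor_le:
  assumes "\<tau> < pi / 2"
  obtains K where "0 \<le> K" "\<And>z. 0 \<le> Re z \<Longrightarrow>
    cmod (stirling_factor z) \<le> exp ((Re z + 1) * ln (Re z + 1) + K * (Re z + 1) - \<tau> * \<bar>Im z\<bar>)"
proof -
  define \<phi> where "\<phi> = (\<lambda>u::real. ln (1 + u\<^sup>2) / 2 - (arctan u - \<tau>) * u)"
  define \<delta> where "\<delta> = (pi / 2 - \<tau>) / 2"
  have \<delta>: "\<delta> > 0" using assms by (simp add: \<delta>_def)
  have "eventually (\<lambda>u. arctan u > \<tau> + \<delta>) at_top"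
    by (rule order_tendstoD(1)[OF tendsto_arctan_at_top]) (use assms in \<open>simp add: \<delta>_def field_simps\<close>)
  moreover have "eventually (\<lambda>u::real. ln (1 + u\<^sup>2) / 2 \<le> \<delta> * u) at_top"
    using \<delta> by real_asymp
  moreover have "eventually (\<lambda>u::real. u \<ge> 0) at_top"
    by (rule eventually_ge_at_top)
  ultimately have "eventually (\<lambda>u. \<phi> u \<le> 0) at_top"
  proof eventually_elim
    case (elim u)
    then have "\<delta> * u \<le> (arctan u - \<tau>) * u" by (intro mult_right_mono) auto
    with elim show ?case by (simp add: \<phi>_def)
  qed
  then obtain U where U: "\<And>u. u \<ge> U \<Longrightarrow> \<phi> u \<le> 0"
    by (auto simp: eventually_at_top_linorder)
  have "continuous_on {0..U} \<phi>"
  proof -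
    have "0 < 1 + u\<^sup>2" for u :: real by (simp add: add_pos_nonneg)
    then have "1 + u\<^sup>2 \<noteq> 0" for u :: real by (metis less_irrefl)
    then show ?thesis
      unfolding \<phi>_def by (intro continuous_intros) auto
  qed
  then have "bounded (\<phi> ` {0..U})"
    by (intro compact_imp_bounded compact_continuous_image) auto
  then obtain B where B: "\<And>u. u \<in> {0..U} \<Longrightarrow> \<bar>\<phi> u\<bar> \<le> B"
    by (fastforce simp: bounded_iff)
  define K where "K = max B 0"
  have K: "\<phi> u \<le> K" if "u \<ge> 0" for u
    using U[of u] B[of u] that by (cases "u \<le> U") (auto simp: K_def)
  show ?thesis
  proof (rule that)
    show "0 \<le> K" by (simp add: K_def)
    fix z assume z: "0 \<le> Re z"
    define s where "s = Re z + 1"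
    define u where "u = \<bar>Im z\<bar> / s"
    have s: "s > 0" and Im: "\<bar>Im z\<bar> = s * u" using z by (auto simp: s_def u_def)
    have "s * (ln s + ln (1 + u\<^sup>2) / 2) - \<bar>Im z\<bar> * arctan u = s * ln s + s * \<phi> u - \<tau> * \<bar>Im z\<bar>"
      unfolding Im \<phi>_def by (simp add: algebra_simps)
    also have "\<dots> \<le> s * ln s + s * K - \<tau> * \<bar>Im z\<bar>"
      using K[of u] s by (auto simp: u_def)
    finally show "cmod (stirling_factor z) \<le> exp ((Re z + 1) * ln (Re z + 1) + K * (Re z + 1) - \<tau> * \<bar>Im z\<bar>)"
      unfolding norm_stirling_factor[OF z] s_def[symmetric] u_def[symmetric] by (simp add: mult.commute)
  qed
qed

section \<open>Multiplicities under multiplication by a zero-free factor\<close>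

text \<open>
  Where \<open>f\<close> vanishes identically near a point, the order is an unspecified value; it still depends
  only on the germ, which is then the same for both functions.
\<close>

lemma zero_mult_times_nonvanishing:
  assumes f: "f analytic_on {z. 0 \<le> Re z}" and u: "u analytic_on {z. 0 \<le> Re z}"
    and nz: "\<And>z. 0 \<le> Re z \<Longrightarrow> u z \<noteq> 0"
  shows "zero_mult (\<lambda>z. f z * u z) = zero_mult f"
proof
  fix z
  show "zero_mult (\<lambda>z. f z * u z) z = zero_mult f z"
  proof (cases "0 \<le> Re z")
    case True
    have f1: "f analytic_on {z}" and u1: "u analytic_on {z}"
      by (rule analytic_on_subset[OF f] analytic_on_subset[OF u], use True in simp)+
    have zu: "zorder u z = 0"
      using zorder_eq_0I[OF u1 nz[OF True]] .
    have "zorder (\<lambda>z. f z * u z) z = zorder f z"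
    proof (cases "frequently (\<lambda>w. f w * u w \<noteq> 0) (at z)")
      case True
      then show ?thesis
        using zorder_times_analytic'[OF isolated_singularity_at_analytic[OF f1] not_essential_analytic[OF f1] u1]
        by (simp add: zu)
    next
      case False
      then have ev: "eventually (\<lambda>w. f w * u w = 0) (at z)"
        by (simp add: frequently_def)
      have "eventually (\<lambda>w. u w \<noteq> 0) (at z)"
        using analytic_at_imp_isCont[OF u1] nz[OF True]
        by (auto simp: isCont_def intro: tendsto_imp_eventually_ne)
      with ev have "eventually (\<lambda>w. f w * u w = f w) (at z)"
        by eventually_elim auto
      then show ?thesis by (rule zorder_cong) simp
    qed
    then show ?thesis
      using True nz[OF True] by (simp add: zero_mult_def closure_rhp)
  qed (simp add: zero_mult_def closure_rhp)
qed

section \<open>From exponential type to the weighted Hardy space\<close>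

lemma nn_integral_exp_abs_finite:
  fixes c :: real
  assumes c: "0 < c"
  shows "(\<integral>\<^sup>+y. ennreal (exp (- c * \<bar>y\<bar>)) \<partial>lborel) < \<infinity>"
proof -
  let ?g = "\<lambda>y::real. ennreal (exp (- c * y)) * indicator {0..} y"
  have "(\<integral>\<^sup>+y. ?g y \<partial>lborel) = 0 - (- exp (- c * 0) / c)"
  proof (rule nn_integral_FTC_atLeast)
    show "((\<lambda>y. - exp (- c * y) / c) has_real_derivative exp (- c * y)) (at y)" for y
      using c by (auto intro!: derivative_eq_intros)
    show "((\<lambda>y. - exp (- c * y) / c) \<longlongrightarrow> 0) at_top"
      using c by real_asymp
  qed auto
  then have fin: "(\<integral>\<^sup>+y. ?g y \<partial>lborel) < \<infinity>" by simp
  have refl: "(\<integral>\<^sup>+y. ?g (- y) \<partial>lborel) = (\<integral>\<^sup>+y. ?g y \<partial>lborel)"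
    using nn_integral_real_affine[of ?g "- 1" 0] by simp
  have "(\<integral>\<^sup>+y. ennreal (exp (- c * \<bar>y\<bar>)) \<partial>lborel) \<le> (\<integral>\<^sup>+y. ?g y + ?g (- y) \<partial>lborel)"
    by (intro nn_integral_mono) (auto simp: indicator_def abs_real_def)
  also have "\<dots> = (\<integral>\<^sup>+y. ?g y \<partial>lborel) + (\<integral>\<^sup>+y. ?g (- y) \<partial>lborel)"
    by (intro nn_integral_add) auto
  finally show ?thesis
    using fin unfolding refl by (simp add: ennreal_add_less_top order_le_less_trans)
qed

lemma power_div_fact_le_exp:
  fixes x :: real
  assumes "0 \<le> x"
  shows "x ^ n / fact n \<le> exp x"
proof -
  have s: "(\<lambda>k. x ^ k / fact k) sums exp x"
    using exp_converges[of x] by (simp add: divide_inverse mult.commute)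
  have "(\<Sum>k\<in>{n}. x ^ k / fact k) \<le> (\<Sum>k. x ^ k / fact k)"
    using assms by (intro sum_le_suminf sums_summable[OF s]) auto
  then show ?thesis using sums_unique[OF s] by simp
qed

text \<open>
  The bound makes the integral over $\Re z = n/2$ at most a constant times
  $(n/2+1)^{n+2} e^{-2n}$. The first power times the weight $2^n/n!$ is less than
  $(n+2)^{n+2}/n! \le (n+1)(n+2) e^{n+2}$, so the factor $e^{-2n}$ ensures
  convergence.
\<close>

lemma M2_omegaI:
  assumes f: "f \<in> Hol_rhp" and \<delta>: "0 < \<delta>" and D: "0 \<le> D"
    and bnd: "\<And>z. 0 \<le> Re z \<Longrightarrow>
      cmod (f z) \<le> D * exp ((Re z + 1) * ln (Re z + 1) - 2 * Re z - \<delta> * \<bar>Im z\<bar>)"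
  shows "f \<in> M2_omega"
proof -
  define H where "H = (\<lambda>x. D\<^sup>2 * exp (2 * ((x + 1) * ln (x + 1)) - 4 * x))"
  have H0: "0 \<le> H x" for x by (simp add: H_def)
  define J where "J = (\<integral>\<^sup>+y. ennreal (exp (- (2 * \<delta>) * \<bar>y\<bar>)) \<partial>lborel)"
  have J: "J < \<infinity>" using nn_integral_exp_abs_finite[of "2 * \<delta>"] \<delta> by (simp add: J_def)
  have ana: "f analytic_on {z. 0 \<le> Re z}"
    using f by (simp add: Hol_rhp_def closure_rhp)
  have cont: "continuous_on {z. 0 \<le> Re z} f"
    by (intro holomorphic_on_imp_continuous_on analytic_imp_holomorphic ana)
  have line: "(\<integral>\<^sup>+y. ennreal ((cmod (f (Complex x y)))\<^sup>2) \<partial>lborel) \<le> ennreal (H x) * J" if x: "0 \<le> x" for x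
  proof -
    have "(\<integral>\<^sup>+y. ennreal ((cmod (f (Complex x y)))\<^sup>2) \<partial>lborel)
        \<le> (\<integral>\<^sup>+y. ennreal (H x) * ennreal (exp (- (2 * \<delta>) * \<bar>y\<bar>)) \<partial>lborel)"
    proof (rule nn_integral_mono)
      fix y :: real
      have "(cmod (f (Complex x y)))\<^sup>2 \<le> (D * exp ((x + 1) * ln (x + 1) - 2 * x - \<delta> * \<bar>y\<bar>))\<^sup>2"
        using bnd[of "Complex x y"] x by (intro power_mono) auto
      also have "\<dots> = H x * exp (- (2 * \<delta>) * \<bar>y\<bar>)"
        by (simp add: H_def power_mult_distrib exp_double[symmetric] exp_add[symmetric] algebra_simps)
      finally show "ennreal ((cmod (f (Complex x y)))\<^sup>2) \<le> ennreal (H x) * ennreal (exp (- (2 * \<delta>) * \<bar>y\<bar>))"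
        using H0[of x] by (simp add: ennreal_mult[symmetric] ennreal_leI)
    qed
    also have "\<dots> = ennreal (H x) * J"
      unfolding J_def by (intro nn_integral_cmult) auto
    finally show ?thesis .
  qed
  have H2: "f \<in> H2 b" if b: "b > 0" for b
  proof -
    define H' where "H' = D\<^sup>2 * exp (2 * ((b + 1) * ln (b + 1)))"
    have "H x \<le> H'" if "0 < x" "x < b" for x
    proof -
      have "(x + 1) * ln (x + 1) \<le> (b + 1) * ln (b + 1)"
        using that by (intro mult_mono) auto
      then show ?thesis
        using that unfolding H_def H'_def by (intro mult_left_mono) auto
    qed
    then have "(SUP x\<in>{0<..<b}. \<integral>\<^sup>+y. ennreal ((cmod (f (Complex x y)))\<^sup>2) \<partial>lborel) \<le> ennreal H' * J"
      by (intro SUP_least order_trans[OF line] mult_right_mono ennreal_leI) auto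
    also have "\<dots> < \<infinity>"
      using J by (simp add: ennreal_mult_less_top)
    finally show ?thesis
      unfolding H2_def using analytic_imp_holomorphic[OF ana]
      by (auto simp: strip_def intro: holomorphic_on_subset)
  qed
  have eq: "bdry_ext f = (\<lambda>z. if z \<in> {z. 0 \<le> Re z} then f z else 0)"
    using bdry_ext_Hol_rhp[OF f] by (auto simp: fun_eq_iff closure_rhp bdry_ext_def)
  have "{z. 0 \<le> Re z} \<in> sets borel" by measurable
  then have meas: "bdry_ext f \<in> borel_measurable borel"
    unfolding eq by (intro borel_measurable_continuous_on_if cont) auto
  have so: "measurable omega N = measurable borel N" for N
    by (intro measurable_cong_sets) (auto simp: omega_def)
  define c where "c = (\<lambda>n::nat. 2 ^ n / fact n * H (real n / 2))"
  have c0: "0 \<le> c n" for n by (simp add: c_def H0)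
  have cle: "c n \<le> D\<^sup>2 * exp 2 / 4 * ((real n + 1) * (real n + 2) * exp (- real n))" for n
  proof -
    have "exp (2 * ((real n / 2 + 1) * ln (real n / 2 + 1))) = ((real n + 2) / 2) ^ (n + 2)"
    proof -
      have "2 * ((real n / 2 + 1) * ln (real n / 2 + 1)) = of_nat (n + 2) * ln ((real n + 2) / 2)"
        by (simp add: field_simps)
      then show ?thesis by (simp only: exp_of_nat_mult) simp
    qed
    moreover have "exp (a - 4 * (real n / 2)) = exp a * exp (- (2 * real n))" for a
      by (simp add: exp_add[symmetric])
    ultimately have "c n = 2 ^ n / fact n * (D\<^sup>2 * (((real n + 2) / 2) ^ (n + 2) * exp (- (2 * real n))))"
      unfolding c_def H_def by (simp only:)
    also have "\<dots> = D\<^sup>2 * (2 ^ n / fact n * ((real n + 2) / 2) ^ (n + 2)) * exp (- (2 * real n))"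
      by (simp only: mult_ac)
    also have "2 ^ n / fact n * ((real n + 2) / 2) ^ (n + 2) = (real n + 1) * (real n + 2) / 4 * ((real n + 2) ^ (n + 2) / fact (n + 2))"
    proof -
      define p q r where "p = (real n + 1) * (real n + 2)" and "q = (real n + 2) ^ (n + 2)" and "r = (fact n :: real)"
      have pr: "p > 0" "r > 0" by (auto simp: p_def r_def intro!: mult_pos_pos add_nonneg_pos)
      have "n + 2 = Suc (Suc n)" by simp
      then have nf: "fact (n + 2) = p * r"
        by (simp only: fact_Suc p_def r_def) (simp add: algebra_simps)
      have "((real n + 2) / 2) ^ (n + 2) = q / (2 ^ n * 4)"
        by (simp add: q_def power_divide power_add)
      then show ?thesis
        unfolding nf p_def[symmetric] q_def[symmetric] r_def[symmetric] using pr by simp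
    qed
    also have "D\<^sup>2 * \<dots> * exp (- (2 * real n)) \<le> D\<^sup>2 * ((real n + 1) * (real n + 2) / 4 * exp (real n + 2)) * exp (- (2 * real n))"
      by (intro mult_right_mono mult_left_mono power_div_fact_le_exp) auto
    also have "\<dots> = D\<^sup>2 * exp 2 / 4 * ((real n + 1) * (real n + 2) * exp (- real n))"
    proof -
      have "exp (real n + 2) * exp (- (2 * real n)) = exp 2 * exp (- real n)"
        by (simp add: exp_add[symmetric])
      then show ?thesis by (simp add: mult_ac)
    qed
    finally show ?thesis .
  qed
  \<comment> \<open>comparison with the geometric series of ratio $e^{-1/2}$\<close>
  have "summable (\<lambda>n. (real n + 1) * (real n + 2) * exp (- real n))"
  proof (rule summable_comparison_test_bigo)
    have "summable (\<lambda>n. exp (- 1 / 2 :: real) ^ n)" by (intro summable_geometric) simp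
    then show "summable (\<lambda>n. norm (exp (- (real n / 2))))"
      by (simp add: exp_of_nat_mult[symmetric])
    show "(\<lambda>n. (real n + 1) * (real n + 2) * exp (- real n)) \<in> O(\<lambda>n. exp (- (real n / 2)))"
      by real_asymp
  qed
  from summable_mult[OF this, of "D\<^sup>2 * exp 2 / 4"] have sumc: "summable c"
    by (rule summable_comparison_test') (use cle c0 in auto)
  have "(\<integral>\<^sup>+z. ennreal ((cmod (bdry_ext f z))\<^sup>2) \<partial>omega)
      = (\<Sum>n. ennreal (2 ^ n / fact n) * (\<integral>\<^sup>+y. ennreal ((cmod (bdry_ext f (Complex (real n / 2) y)))\<^sup>2) \<partial>lborel))"
    by (rule nn_integral_omega) (use meas in measurable)
  also have "\<dots> \<le> (\<Sum>n. ennreal (c n) * J)"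
  proof (intro suminf_le allI summableI)
    fix n :: nat
    have "ennreal (2 ^ n / fact n) * (\<integral>\<^sup>+y. ennreal ((cmod (bdry_ext f (Complex (real n / 2) y)))\<^sup>2) \<partial>lborel)
        \<le> ennreal (2 ^ n / fact n) * (ennreal (H (real n / 2)) * J)"
      using line[of "real n / 2"] by (intro mult_left_mono) (simp_all add: eq)
    also have "\<dots> = ennreal (c n) * J"
      unfolding c_def by (subst ennreal_mult) (use H0 in \<open>auto simp: mult.assoc\<close>)
    finally show "ennreal (2 ^ n / fact n) * (\<integral>\<^sup>+y. ennreal ((cmod (bdry_ext f (Complex (real n / 2) y)))\<^sup>2) \<partial>lborel)
        \<le> ennreal (c n) * J" .
  qed
  also have "\<dots> = (\<Sum>n. ennreal (c n)) * J"
    by (rule ennreal_suminf_multc)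
  also have "(\<Sum>n. ennreal (c n)) = ennreal (\<Sum>n. c n)"
    by (intro suminf_ennreal2 c0 sumc)
  also have "ennreal (\<Sum>n. c n) * J < \<infinity>"
    using J by (simp add: ennreal_mult_less_top)
  finally have "integrable omega (\<lambda>z. (cmod (bdry_ext f z))\<^sup>2)"
    using meas by (subst integrable_iff_bounded) (simp add: so)
  moreover have "f holomorphic_on rhp"
    using analytic_imp_holomorphic[OF ana] by (rule holomorphic_on_subset) (auto simp: rhp_def)
  ultimately show ?thesis
    using H2 meas unfolding M2_omega_def by (simp add: so)
qed

lemma zero_sets_exp_type_less_subset: "zero_sets (exp_type_less (pi / 2)) \<subseteq> zero_sets (M2_omega \<inter> Hol_rhp)"
proof
  fix m assume "m \<in> zero_sets (exp_type_less (pi / 2))"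
  then obtain g z0 \<tau> where g: "g \<in> exp_type \<tau>" and \<tau>: "0 \<le> \<tau>" "\<tau> < pi / 2"
    and z0: "0 \<le> Re z0" "g z0 \<noteq> 0" and m: "m = zero_mult g"
    by (auto simp: zero_sets_def exp_type_less_def closure_rhp)
  define \<delta> where "\<delta> = (pi / 2 - \<tau>) / 3"
  have \<delta>: "\<delta> > 0" "\<tau> + 2 * \<delta> < pi / 2" using \<tau> by (auto simp: \<delta>_def field_simps)
  have ana: "g analytic_on {z. 0 \<le> Re z}"
    using g by (simp add: exp_type_def Hol_rhp_def closure_rhp)
  obtain C where C: "C > 0" "\<And>z. 0 \<le> Re z \<Longrightarrow> cmod (g z) \<le> C * exp ((\<tau> + \<delta>) * cmod z)"
    using g \<delta>(1) unfolding exp_type_def closure_rhp by blast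
  obtain K where K: "0 \<le> K" "\<And>z. 0 \<le> Re z \<Longrightarrow>
      cmod (stirling_factor z) \<le> exp ((Re z + 1) * ln (Re z + 1) + K * (Re z + 1) - (\<tau> + 2 * \<delta>) * \<bar>Im z\<bar>)"
    using norm_stirling_factor_le[OF \<delta>(2)] by blast
  \<comment> \<open>The exponent $K + \tau + \delta$ cancels the linear growth in \<open>Re z\<close> of the two estimates, and 2 more
    gives the decay for \<open>M2_omegaI\<close>.\<close>
  define u where "u = (\<lambda>z. stirling_factor z * exp (- of_real (K + \<tau> + \<delta> + 2) * z))"
  have u: "u analytic_on {z. 0 \<le> Re z}"
    unfolding u_def by (intro analytic_intros stirling_factor_analytic)
  have nz: "u z \<noteq> 0" for z by (simp add: u_def stirling_factor_def)
  define f where "f = (\<lambda>z. g z * u z)"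
  have f: "f \<in> Hol_rhp"
    unfolding f_def Hol_rhp_def closure_rhp mem_Collect_eq by (intro analytic_on_mult ana u)
  have "f \<in> M2_omega"
  proof (rule M2_omegaI[OF f \<delta>(1), of "C * exp K"])
    fix z assume z: "0 \<le> Re z"
    let ?s = "Re z + 1"
    have "(\<tau> + \<delta>) * cmod z \<le> (\<tau> + \<delta>) * (Re z + \<bar>Im z\<bar>)"
      using \<tau> \<delta> z cmod_le[of z] by (intro mult_left_mono) auto
    then have "cmod (g z) \<le> C * exp ((\<tau> + \<delta>) * (Re z + \<bar>Im z\<bar>))"
      using C(1) by (intro order_trans[OF C(2)[OF z]] mult_left_mono) auto
    then have "cmod (f z) \<le> C * exp ((\<tau> + \<delta>) * (Re z + \<bar>Im z\<bar>)) *
        (exp (?s * ln ?s + K * ?s - (\<tau> + 2 * \<delta>) * \<bar>Im z\<bar>) * exp (- (K + \<tau> + \<delta> + 2) * Re z))"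
      using K(2)[OF z] C(1) unfolding f_def u_def norm_mult
      by (intro mult_mono) auto
    also have "\<dots> = C * exp K * exp (?s * ln ?s - 2 * Re z - \<delta> * \<bar>Im z\<bar>)"
    proof -
      have "(\<tau> + \<delta>) * (Re z + \<bar>Im z\<bar>) + (?s * ln ?s + K * ?s - (\<tau> + 2 * \<delta>) * \<bar>Im z\<bar>) + (- (K + \<tau> + \<delta> + 2) * Re z)
          = K + (?s * ln ?s - 2 * Re z - \<delta> * \<bar>Im z\<bar>)"
        by (simp add: algebra_simps)
      then show ?thesis
        by (simp only: mult.assoc exp_add[symmetric] add.assoc)
    qed
    finally show "cmod (f z) \<le> C * exp K * exp (?s * ln ?s - 2 * Re z - \<delta> * \<bar>Im z\<bar>)" .
  qed (use C in auto)
  moreover have "f z0 \<noteq> 0" using z0 nz by (simp add: f_def)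
  moreover have "zero_mult f = m"
    unfolding m f_def by (rule zero_mult_times_nonvanishing[OF ana u nz])
  ultimately show "m \<in> zero_sets (M2_omega \<inter> Hol_rhp)"
    using f z0 unfolding zero_sets_def closure_rhp by blast
qed

section \<open>From the weighted Hardy space to exponential type\<close>

lemma M2_omega_line_integrals:
  assumes f: "f \<in> M2_omega" "f \<in> Hol_rhp"
  obtains K where "0 < K" and "\<And>n :: nat. (\<integral>\<^sup>+y. ennreal ((cmod (f (Complex (real n / 2) y)))\<^sup>2) \<partial>lborel)
    \<le> ennreal (K * fact n / 2 ^ n)"
proof -
  have meas: "bdry_ext f \<in> borel_measurable borel"
    and int: "integrable omega (\<lambda>z. (cmod (bdry_ext f z))\<^sup>2)"
    using f(1) by (auto simp: M2_omega_def omega_def)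
  define A where "A = (\<lambda>n::nat. \<integral>\<^sup>+y. ennreal ((cmod (f (Complex (real n / 2) y)))\<^sup>2) \<partial>lborel)"
  have "(\<Sum>n. ennreal (2 ^ n / fact n) * A n) = (\<integral>\<^sup>+z. ennreal ((cmod (bdry_ext f z))\<^sup>2) \<partial>omega)"
    using meas by (subst nn_integral_omega) (auto simp: A_def bdry_ext_Hol_rhp[OF f(2)] closure_rhp)
  also have "\<dots> < \<infinity>"
    using int by (auto simp: integrable_iff_bounded)
  finally obtain K where K: "(\<Sum>n. ennreal (2 ^ n / fact n) * A n) = ennreal K" "0 \<le> K"
    by (cases "\<Sum>n. ennreal (2 ^ n / fact n) * A n" rule: ennreal_cases) auto
  have "A n \<le> ennreal ((K + 1) * fact n / 2 ^ n)" for n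
  proof -
    have "(\<Sum>n\<in>{n}. ennreal (2 ^ n / fact n) * A n) \<le> (\<Sum>n. ennreal (2 ^ n / fact n) * A n)"
      by (intro sum_le_suminf summableI) auto
    then have le: "ennreal (2 ^ n / fact n) * A n \<le> ennreal K"
      unfolding K by simp
    have "A n = ennreal (fact n / 2 ^ n) * (ennreal (2 ^ n / fact n) * A n)"
      by (simp add: mult.assoc[symmetric] ennreal_mult[symmetric])
    also have "\<dots> \<le> ennreal (fact n / 2 ^ n) * ennreal K"
      by (intro mult_left_mono le) auto
    also have "\<dots> = ennreal (fact n / 2 ^ n * K)"
      by (rule ennreal_mult[symmetric]) (use K in auto)
    also have "\<dots> \<le> ennreal ((K + 1) * fact n / 2 ^ n)"
      by (intro ennreal_leI) (simp add: field_simps)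
    finally show ?thesis .
  qed
  then show ?thesis
    using K(2) by (intro that[of "K + 1"]) (auto simp: A_def)
qed

text \<open>
  The nearest half-integer line to $z$ is $\Re = n/2$; the strip of width 1 around it has both edges on
  lines with controlled integrals and at distance at least $1/4$ from $z$. The condition
  $\Re z \ge 1/4$ guarantees $n \ge 1$, so that the strip lies in the half-plane. In between, $n!/2^n \le (n/2)^n$
  turns the square root of the weight into $(x+1)^{x+1}$.
\<close>

lemma growth_of_line_integrals:
  assumes ana: "f analytic_on {z. 0 \<le> Re z}"
    and weak: "\<And>b. \<exists>C. \<forall>z. 0 < Re z \<and> Re z \<le> b \<longrightarrow> cmod (f z) * Re z \<le> C"
    and K: "0 < K"
    and line: "\<And>n :: nat. (\<integral>\<^sup>+y. ennreal ((cmod (f (Complex (real n / 2) y)))\<^sup>2) \<partial>lborel) \<le> ennreal (K * fact n / 2 ^ n)"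
    and z: "1 / 4 \<le> Re z"
  shows "cmod (f z) \<le> 12 * sqrt K * exp ((Re z + 1) * ln (Re z + 1))"
proof -
  have hol: "f holomorphic_on {z. 0 \<le> Re z}" and cont: "continuous_on {z. 0 \<le> Re z} f"
    using ana by (auto intro: analytic_imp_holomorphic holomorphic_on_imp_continuous_on)
  define n where "n = nat \<lfloor>2 * Re z + 1 / 2\<rfloor>"
  have n: "real n \<le> 2 * Re z + 1 / 2" "2 * Re z - 1 / 2 < real n"
    using z by (auto simp: n_def) linarith+
  then have "real n > 0" using z by linarith
  then obtain k where k: "n = Suc k" by (cases n) auto
  \<comment> \<open>\<open>Q\<close> bounds the integrals over both edges; the factor 4 covers the left one, where the power of 2
    is smaller by 4.\<close>
  define Q where "Q = 4 * K * fact (k + 2) / 2 ^ (k + 2)"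
  have Q: "Q > 0" using K by (simp add: Q_def)
  obtain C where C: "\<And>z. 0 < Re z \<Longrightarrow> Re z \<le> real (k + 2) / 2 \<Longrightarrow> cmod (f z) * Re z \<le> C"
    using weak by blast
  define F where "F = (\<lambda>w. f w / sqrt Q)"
  have nF: "cmod (F w) = cmod (f w) / sqrt Q" for w
    using Q by (simp add: F_def norm_divide)
  have edge: "(\<integral>\<^sup>+y. ennreal ((cmod (F (Complex (real m / 2) y)))\<^sup>2) \<partial>lborel) \<le> 1"
    if m: "K * fact m / 2 ^ m \<le> Q" for m :: nat
  proof -
    have "continuous_on UNIV (\<lambda>y. f (Complex (real m / 2) y))"
      by (rule continuous_on_compose2[OF cont]) (auto simp: Complex_eq intro!: continuous_intros)
    then have "(\<lambda>y. ennreal ((cmod (f (Complex (real m / 2) y)))\<^sup>2)) \<in> borel_measurable lborel"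
      by (auto intro!: measurable_compose[OF _ measurable_ennreal] borel_measurable_continuous_onI continuous_intros)
    note cm = nn_integral_cmult[OF this]
    have "(\<integral>\<^sup>+y. ennreal ((cmod (F (Complex (real m / 2) y)))\<^sup>2) \<partial>lborel)
        = (\<integral>\<^sup>+y. ennreal (1 / Q) * ennreal ((cmod (f (Complex (real m / 2) y)))\<^sup>2) \<partial>lborel)"
      using Q by (intro nn_integral_cong) (simp add: nF power_divide ennreal_mult[symmetric])
    also have "\<dots> = ennreal (1 / Q) * (\<integral>\<^sup>+y. ennreal ((cmod (f (Complex (real m / 2) y)))\<^sup>2) \<partial>lborel)"
      by (rule cm)
    also have "\<dots> \<le> ennreal (1 / Q) * ennreal Q"
      using m by (intro mult_left_mono order_trans[OF line] ennreal_leI) auto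
    also have "\<dots> = 1"
      using Q by (simp add: ennreal_mult[symmetric])
    finally show ?thesis .
  qed
  \<comment> \<open>Any radius below $1/4$ serves; the distance to an edge may be exactly $1/4$.\<close>
  have "cmod (F z) \<le> 1 + 1 / (1 / 5)"
  proof (rule strip_bound_from_edge_integrals[where f = F and z = z and a = "real k / 2" and b = "real (k + 2) / 2" and C = "C / sqrt Q"])
    show "continuous_on {z. real k / 2 \<le> Re z \<and> Re z \<le> real (k + 2) / 2} F"
      unfolding F_def using Q by (intro continuous_intros continuous_on_subset[OF cont]) auto
    show "F holomorphic_on {z. real k / 2 < Re z \<and> Re z < real (k + 2) / 2}"
      unfolding F_def using Q by (intro holomorphic_intros holomorphic_on_subset[OF hol]) auto
    show "cmod (F w) * (Re w - real k / 2) \<le> C / sqrt Q" if w: "real k / 2 < Re w" "Re w < real (k + 2) / 2" for w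
    proof -
      have pos: "0 < Re w" using w(1) by (rule le_less_trans[rotated]) simp
      have "cmod (f w) * (Re w - real k / 2) \<le> cmod (f w) * Re w"
        by (intro mult_left_mono) auto
      also have "\<dots> \<le> C" using C[OF pos] w(2) by simp
      finally show ?thesis
        unfolding nF using Q by (simp add: divide_right_mono)
    qed
    have "(fact k :: real) \<le> fact (k + 2)" by (intro fact_mono) simp
    then have "K * fact k / 2 ^ k \<le> Q"
      using K by (simp add: Q_def power_add divide_right_mono)
    then show "(\<integral>\<^sup>+y. ennreal ((cmod (F (Complex (real k / 2) y)))\<^sup>2) \<partial>lborel) \<le> 1"
      by (rule edge)
    show "(\<integral>\<^sup>+y. ennreal ((cmod (F (Complex (real (k + 2) / 2) y)))\<^sup>2) \<partial>lborel) \<le> 1"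
    proof (rule edge)
      have "Q = 4 * (K * fact (k + 2) / 2 ^ (k + 2))" by (simp add: Q_def)
      moreover have "0 \<le> K * fact (k + 2) / 2 ^ (k + 2)" using K by simp
      ultimately show "K * fact (k + 2) / 2 ^ (k + 2) \<le> Q" by linarith
    qed
  qed (use n k in auto)
  then have 1: "cmod (f z) \<le> 6 * sqrt Q"
    using Q by (simp add: nF divide_le_eq)
  define s where "s = Re z + 1"
  have s: "s > 0" "real (k + 2) / 2 \<le> s" using n k z by (auto simp: s_def)
  have "(fact (k + 2) :: real) \<le> real (k + 2) ^ (k + 2)"
    using fact_le_power[of "k + 2", where 'a = real] by (simp only: of_nat_power)
  then have "fact (k + 2) / 2 ^ (k + 2) \<le> (real (k + 2) / 2) ^ (k + 2)"
    unfolding power_divide by (elim divide_right_mono) simp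
  also have "\<dots> \<le> s ^ (k + 2)"
    using s by (intro power_mono) auto
  also have "\<dots> = exp (real (k + 2) * ln s)"
    using s by (simp only: exp_of_nat_mult exp_ln)
  also have "\<dots> \<le> exp (2 * s * ln s)"
    using s z by (intro exp_le_cancel_iff[THEN iffD2] mult_right_mono) (auto simp: s_def)
  finally have "4 * K * (fact (k + 2) / 2 ^ (k + 2)) \<le> 4 * K * exp (2 * s * ln s)"
    using K by (intro mult_left_mono) auto
  also have "\<dots> = (2 * sqrt K * exp (s * ln s))\<^sup>2"
    using K by (simp add: power_mult_distrib exp_double[symmetric] mult.assoc)
  finally have "4 * K * (fact (k + 2) / 2 ^ (k + 2)) \<le> (2 * sqrt K * exp (s * ln s))\<^sup>2" .
  then have "sqrt Q \<le> sqrt ((2 * sqrt K * exp (s * ln s))\<^sup>2)"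
    unfolding Q_def real_sqrt_le_iff by (simp only: times_divide_eq_right)
  also have "\<dots> = 2 * sqrt K * exp (s * ln s)"
    using K by (simp only: real_sqrt_abs) simp
  finally show ?thesis
    using 1 by (simp add: s_def)
qed

text \<open>
  On the axis $|f| e^{-|f|^2} \le 1$, on the line $\Re z = 1/4$ the given weak bound applies, and the
  maximum principle fills in the strip.
\<close>

lemma bounded_near_axis:
  assumes ana: "f analytic_on {z. 0 \<le> Re z}"
    and weak: "\<And>z. 0 < Re z \<Longrightarrow> Re z \<le> 1 / 4 \<Longrightarrow> cmod (f z) * Re z \<le> C"
    and L: "L analytic_on {z. 0 \<le> Re z}" "\<And>z. 0 \<le> Re z \<Longrightarrow> 0 \<le> Re (L z)"
      "\<And>y. (cmod (f (Complex 0 y)))\<^sup>2 \<le> Re (L (Complex 0 y))"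
    and z: "0 \<le> Re z" "Re z \<le> 1 / 4"
  shows "cmod (f z * exp (- L z)) \<le> max 1 (4 * C)"
proof (rule strip_maximum_principle[where f = "\<lambda>z. f z * exp (- L z)" and z = z and a = 0 and b = "1 / 4" and C = C])
  have an: "(\<lambda>z. f z * exp (- L z)) analytic_on {z. 0 \<le> Re z}"
    by (intro analytic_intros ana L)
  show "continuous_on {z. 0 \<le> Re z \<and> Re z \<le> 1 / 4} (\<lambda>z. f z * exp (- L z))"
    using an by (intro holomorphic_on_imp_continuous_on analytic_imp_holomorphic) (auto elim: analytic_on_subset)
  show "(\<lambda>z. f z * exp (- L z)) holomorphic_on {z. 0 < Re z \<and> Re z < 1 / 4}"
    using an by (intro analytic_imp_holomorphic) (auto elim: analytic_on_subset)
  have le: "cmod (f w * exp (- L w)) \<le> cmod (f w)" if "0 \<le> Re w" for w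
  proof -
    have "exp (- Re (L w)) \<le> 1" using L(2)[OF that] by simp
    from mult_left_mono[OF this, of "cmod (f w)"] show ?thesis by (simp add: norm_mult)
  qed
  show "cmod (f w * exp (- L w)) * (Re w - 0) \<le> C" if w: "0 < Re w" "Re w < 1 / 4" for w
  proof -
    have "cmod (f w * exp (- L w)) * Re w \<le> cmod (f w) * Re w"
      using w by (intro mult_right_mono le) auto
    also have "\<dots> \<le> C" using w by (intro weak) auto
    finally show ?thesis by simp
  qed
  show "cmod (f w * exp (- L w)) \<le> max 1 (4 * C)" if w: "Re w = 1 / 4" for w
    using le[of w] weak[of w] w by (simp add: max.coboundedI2)
  show "cmod (f w * exp (- L w)) \<le> max 1 (4 * C)" if w: "Re w = 0" for w
  proof -
    have "w = Complex 0 (Im w)" using w by (simp add: complex_eq_iff)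
    then have "(cmod (f w))\<^sup>2 \<le> Re (L w)" using L(3) by metis
    moreover have "2 * cmod (f w) \<le> (cmod (f w))\<^sup>2 + 1"
      using sum_squares_bound[of "cmod (f w)" 1] by simp
    ultimately have "cmod (f w) \<le> 1 + Re (L w)"
      using zero_le_power2[of "cmod (f w)"] by linarith
    also have "\<dots> \<le> exp (Re (L w))" by (rule exp_ge_add_one_self)
    finally have "cmod (f w) * exp (- Re (L w)) \<le> 1"
      by (simp add: exp_minus field_simps)
    then show ?thesis by (simp add: norm_mult)
  qed
qed (use z in auto)

lemma zero_sets_M2_omega_subset: "zero_sets (M2_omega \<inter> Hol_rhp) \<subseteq> zero_sets (exp_type (pi / 2))"
proof
  fix m assume "m \<in> zero_sets (M2_omega \<inter> Hol_rhp)"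
  then obtain f z0 where f: "f \<in> M2_omega" "f \<in> Hol_rhp"
    and z0: "0 \<le> Re z0" "f z0 \<noteq> 0" and m: "m = zero_mult f"
    by (auto simp: zero_sets_def closure_rhp)
  have ana: "f analytic_on {z. 0 \<le> Re z}"
    using f(2) by (simp add: Hol_rhp_def closure_rhp)
  have weak: "\<exists>C. \<forall>z. 0 < Re z \<and> Re z \<le> b \<longrightarrow> cmod (f z) * Re z \<le> C" for b
  proof -
    have "f \<in> H2 (2 * (\<bar>b\<bar> + 1))" using f(1) by (auto simp: M2_omega_def)
    then obtain C where "\<And>z. 0 < Re z \<Longrightarrow> Re z \<le> 2 * (\<bar>b\<bar> + 1) / 2 \<Longrightarrow> cmod (f z) * Re z \<le> C"
      using H2_mult_Re_bounded by blast
    then show ?thesis by (intro exI[of _ C]) auto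
  qed
  obtain K where K: "0 < K" "\<And>n :: nat. (\<integral>\<^sup>+y. ennreal ((cmod (f (Complex (real n / 2) y)))\<^sup>2) \<partial>lborel)
      \<le> ennreal (K * fact n / 2 ^ n)"
    using M2_omega_line_integrals[OF f] by blast
  have cont: "continuous_on UNIV (\<lambda>y. (cmod (f (Complex 0 y)))\<^sup>2)"
    by (intro continuous_intros continuous_on_compose2[OF holomorphic_on_imp_continuous_on[OF analytic_imp_holomorphic[OF ana]]])
       (auto simp: Complex_eq intro!: continuous_intros)
  have "(\<integral>\<^sup>+y. ennreal ((cmod (f (Complex 0 y)))\<^sup>2) \<partial>lborel) < \<infinity>"
    using K(2)[of 0] by (simp add: order_le_less_trans)
  from exists_positive_real_part_majorant[OF cont _ this]
  obtain L where L: "L analytic_on {z. 0 \<le> Re z}" "\<And>z. 0 \<le> Re z \<Longrightarrow> 0 \<le> Re (L z)"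
      "\<And>y. (cmod (f (Complex 0 y)))\<^sup>2 \<le> Re (L (Complex 0 y))"
    by auto
  obtain C0 where C0: "\<And>z. 0 < Re z \<Longrightarrow> Re z \<le> 1 / 4 \<Longrightarrow> cmod (f z) * Re z \<le> C0"
    using weak[of "1 / 4"] by blast
  define C where "C = max 1 (4 * C0) + 12 * sqrt K"
  have "0 < sqrt K" "1 \<le> max 1 (4 * C0)" using K(1) by auto
  then have C: "C > 0" "max 1 (4 * C0) \<le> C" "12 * sqrt K \<le> C" unfolding C_def by linarith+
  define u where "u = (\<lambda>z. exp (- L z) / stirling_factor z)"
  have snz: "stirling_factor z \<noteq> 0" for z by (simp add: stirling_factor_def)
  have u: "u analytic_on {z. 0 \<le> Re z}"
    unfolding u_def using snz by (intro analytic_intros stirling_factor_analytic L) auto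
  have nz: "u z \<noteq> 0" for z by (simp add: u_def snz)
  define g where "g = (\<lambda>z. f z * u z)"
  have g: "g analytic_on {z. 0 \<le> Re z}"
    unfolding g_def by (intro analytic_on_mult ana u)
  have fL: "cmod (f z * exp (- L z)) \<le> C * exp ((Re z + 1) * ln (Re z + 1))" if z: "0 \<le> Re z" for z
  proof (cases "Re z \<le> 1 / 4")
    case True
    have "cmod (f z * exp (- L z)) \<le> C * 1"
      using order_trans[OF bounded_near_axis[OF ana C0 L z True] C(2)] by simp
    also have "\<dots> \<le> C * exp ((Re z + 1) * ln (Re z + 1))"
      using C z by (intro mult_left_mono) auto
    finally show ?thesis .
  next
    case False
    have "exp (- Re (L z)) \<le> 1" using L(2)[OF z] by simp
    from mult_left_mono[OF this, of "cmod (f z)"]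
    have "cmod (f z * exp (- L z)) \<le> cmod (f z)" by (simp add: norm_mult)
    also have "\<dots> \<le> 12 * sqrt K * exp ((Re z + 1) * ln (Re z + 1))"
      using False by (intro growth_of_line_integrals[OF ana weak K]) auto
    also have "\<dots> \<le> C * exp ((Re z + 1) * ln (Re z + 1))"
      using C by (intro mult_right_mono) auto
    finally show ?thesis .
  qed
  have gle: "cmod (g z) \<le> C * exp (pi / 2 * cmod z)" if z: "0 \<le> Re z" for z
  proof -
    let ?E = "exp ((Re z + 1) * ln (Re z + 1))"
    have "cmod (g z) = cmod (f z * exp (- L z)) / cmod (stirling_factor z)"
      by (simp add: g_def u_def norm_mult norm_divide)
    also have "\<dots> \<le> (C * ?E) / exp ((Re z + 1) * ln (Re z + 1) - pi / 2 * \<bar>Im z\<bar>)"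
      using C by (intro frac_le fL z norm_stirling_factor_ge) auto
    also have "\<dots> = C * exp (pi / 2 * \<bar>Im z\<bar>)"
      by (simp add: exp_diff)
    also have "\<dots> \<le> C * exp (pi / 2 * cmod z)"
      using C abs_Im_le_cmod[of z] by (intro mult_left_mono) auto
    finally show ?thesis .
  qed
  have "g \<in> exp_type (pi / 2)"
    unfolding exp_type_def closure_rhp Hol_rhp_def mem_Collect_eq
  proof (intro conjI allI impI g)
    fix \<epsilon> :: real assume \<epsilon>: "\<epsilon> > 0"
    have "cmod (g z) \<le> C * exp ((pi / 2 + \<epsilon>) * cmod z)" if "0 \<le> Re z" for z
    proof -
      have "C * exp (pi / 2 * cmod z) \<le> C * exp ((pi / 2 + \<epsilon>) * cmod z)"
        using C \<epsilon> by (intro mult_left_mono exp_le_cancel_iff[THEN iffD2] mult_right_mono) auto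
      with gle[OF that] show ?thesis by linarith
    qed
    then show "\<exists>C>0. \<forall>z\<in>{z. 0 \<le> Re z}. cmod (g z) \<le> C * exp ((pi / 2 + \<epsilon>) * cmod z)"
      using C by blast
  qed
  moreover have "g z0 \<noteq> 0" using z0 nz by (simp add: g_def)
  moreover have "zero_mult g = m"
    unfolding m g_def by (rule zero_mult_times_nonvanishing[OF ana u nz])
  ultimately show "m \<in> zero_sets (exp_type (pi / 2))"
    using z0 unfolding zero_sets_def closure_rhp by blast
qed

theorem proposition4p1:
  "zero_sets (exp_type_less (pi / 2)) \<subseteq> zero_sets (M2_omega \<inter> Hol_rhp)
   \<and> zero_sets (M2_omega \<inter> Hol_rhp) \<subseteq> zero_sets (exp_type (pi / 2))"
  using zero_sets_exp_type_less_subset zero_sets_M2_omega_subset by (rule conjI)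

end
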